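(* Let $1\le q\le\infty$ and let $f:\mathbb{Z}\to\mathbb{R}$ satisfy $\frac{f}{1+|\cdot|^\alpha}\in\ell^q(\mathbb{Z},\mu)$ for a certain $\alpha>0$. Then: (1) There is a constant $C>0$, independent of $t$, such that for every $t>0$, $$\left\|\frac{e^{t\Delta_d}f}{1+|\cdot|^\alpha}\right\|_{\ell^q(\mathbb{Z},\mu)}\le C\left(1+t^{\frac{\alpha+1/q}{2}}\right)$$ (with $1/q=0$ if $q=\infty$). (2) For every $n\in\mathbb{Z}$ and all $m,l\in\mathbb{N}_0$ such that $\frac m2+l>\frac\alpha2$, $$\partial_t^l\delta_{right}^me^{t\Delta_d}f(n)\to0\quad\text{as }t\to\infty.$$
   Context: $\mathbb{N}_0=\{0,1,2,\dots\}$. For $f:\mathbb{Z}\to\mathbb{R}$, $\delta_{right}f(n)=f(n)-f(n+1)$ and $\delta_{right}^m$ is its $m$-fold composition ($\delta_{right}^0f=f$). Weighted space: $\mu=\sum_{n\in\mathbb{Z}}\frac{1}{1+|n|}\delta_n$ ($\delta_n$ the Dirac measure at $n$); $\|g\|_{\ell^q(\mathbb{Z},\mu)}=\left(\sum_n|g(n)|^q\frac1{1+|n|}\right)^{1/q}$ for $1\le q<\infty$, and $\ell^\infty(\mathbb{Z},\mu)=\ell^\infty(\mathbb{Z})$. The expression $\frac{f}{1+|\cdot|^\alpha}$ is the sequence $n\mapsto\frac{f(n)}{1+|n|^\alpha}$. Discrete Laplacian: $\Delta_df(n)=f(n+1)-2f(n)+f(n-1)$. Heat semigroup: $e^{t\Delta_d}f(n)=\sum_{j\in\mathbb{Z}}G(t,n-j)f(j)$,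 with $G(t,n)=e^{-2t}I_n(2t)$, $t>0$, $n\in\mathbb{Z}$, and $I_n$ the modified Bessel function of the first kind of order $n$. *)

theory Defs
  imports "HOL-Analysis.Analysis"
begin

text \<open>
  Modified Bessel function of the first kind of integer order. Since \<open>rGamma\<close> is the entire
  reciprocal Gamma function, the terms with \<open>k + n < 0\<close> vanish, so that the negative exponents
  of \<open>x / 2\<close> play no role and \<open>bessel_I (- n) = bessel_I n\<close>.
\<close>
definition bessel_I :: "int \<Rightarrow> real \<Rightarrow> real" where
  "bessel_I n x =
     (\<Sum>k. (x / 2) powi (2 * int k + n) * rGamma (of_int (int k + n + 1)) / fact k)"

definition heat_kernel :: "real \<Rightarrow> int \<Rightarrow> real" where
  "heat_kernel t n = exp (- 2 * t) * bessel_I n (2 * t)"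

definition heat_semigroup :: "real \<Rightarrow> (int \<Rightarrow> real) \<Rightarrow> int \<Rightarrow> real" where
  "heat_semigroup t f n = (\<Sum>\<^sub>\<infinity>j\<in>UNIV. heat_kernel t (n - j) * f j)"

definition delta_right :: "(int \<Rightarrow> real) \<Rightarrow> int \<Rightarrow> real" where
  "delta_right f n = f n - f (n + 1)"

text \<open>
  The space \<open>\<ell>\<^sup>q(\<int>, \<mu>)\<close> with \<open>\<mu>\<close> giving mass \<open>1 / (1 + \<bar>n\<bar>)\<close> to the point \<open>n\<close>. The real-valued
  \<open>lq_mu_norm\<close> is meaningful only for members of the space, hence it should always be
  accompanied by \<open>in_lq_mu\<close>.
\<close>
definition in_lq_mu :: "ereal \<Rightarrow> (int \<Rightarrow> real) \<Rightarrow> bool" where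
  "in_lq_mu q g \<longleftrightarrow>
     (if q = \<infinity> then bounded (range g)
      else (\<lambda>n. \<bar>g n\<bar> powr real_of_ereal q * (1 / (1 + real_of_int \<bar>n\<bar>))) summable_on UNIV)"

definition lq_mu_norm :: "ereal \<Rightarrow> (int \<Rightarrow> real) \<Rightarrow> real" where
  "lq_mu_norm q g =
     (if q = \<infinity> then (SUP n. \<bar>g n\<bar>)
      else (\<Sum>\<^sub>\<infinity>n\<in>UNIV. \<bar>g n\<bar> powr real_of_ereal q * (1 / (1 + real_of_int \<bar>n\<bar>)))
             powr (1 / real_of_ereal q))"

definition div_growth :: "real \<Rightarrow> (int \<Rightarrow> real) \<Rightarrow> int \<Rightarrow> real" where
  "div_growth \<alpha> f n = f n / (1 + real_of_int \<bar>n\<bar> powr \<alpha>)"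

end

theory Submission
  imports Defs
begin

text \<open>
  The heat kernel is a correlation of Poisson weights. With \<open>p\<^sub>t(i) = exp (- t) t\<^sup>i / i!\<close> for
  \<open>i \<ge> 0\<close> and \<open>p\<^sub>t(i) = 0\<close> otherwise, the Bessel series says
  \<open>G(t, n) = (\<Sum>i\<in>\<int>. p\<^sub>t(i - n) p\<^sub>t(i))\<close>: the continuous time random walk is the difference of
  two independent Poisson variables. Put \<open>s = sqrt (1 + t)\<close>. All estimates say that \<open>G(t, \<cdot>)\<close>
  lives at scale \<open>s\<close> with exponential tails, and that each difference gains a factor \<open>1 / s\<close>.

  The tails come from the explicit Laplace transform of \<open>p\<^sub>t\<close>, which bounds
  \<open>(\<Sum>i. p\<^sub>t(i) exp (c \<bar>i - t\<bar> / s))\<close> independently of \<open>t\<close> (\<open>pois_exp_abs_sum_le\<close>). For the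
  differences, \<open>i p\<^sub>t(i) = t p\<^sub>t(i - 1)\<close> yields a three term recursion in the order of the backward
  difference (\<open>delta_left_pois_rec\<close>), in which each further order costs \<open>\<bar>i - t\<bar> / t\<close>, that is
  \<open>1 / s\<close> in the natural scale. Since a difference of \<open>G\<close> in \<open>n\<close> falls on one of the two Poisson
  factors, \<open>\<delta>\<^sup>M G(t, \<cdot>)\<close> has size \<open>s\<^sup>-\<^sup>M\<close> in the weighted \<open>\<ell>\<^sup>1\<close> norm with weight
  \<open>exp (\<bar>n\<bar> / s)\<close>, and summing one more difference gives size \<open>s\<^sup>-\<^sup>M\<^sup>-\<^sup>1\<close> in the weighted supremum
  norm (\<open>delta_heat_kernel_weighted_sum_le\<close>, \<open>delta_heat_kernel_weighted_sup_le\<close>).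

  Part (1). By Jensen's inequality it suffices to control
  \<open>W(j) (\<Sum>n. G(t, n - j) / W(n))\<close> for the weight \<open>W(n) = (1 + \<bar>n\<bar>\<^sup>\<alpha>)\<^sup>q (1 + \<bar>n\<bar>)\<close>. The
  inequality \<open>1 + \<bar>j\<bar> \<le> (1 + \<bar>n\<bar>) (1 + \<bar>n - j\<bar>)\<close> reduces this to the moment of \<open>G(t, \<cdot>)\<close> of
  order \<open>\<alpha> q + 1\<close>, which is at most a multiple of \<open>s\<close> to the power \<open>\<alpha> q + 1\<close>
  (\<open>heat_semigroup_lq_bound\<close>, and \<open>heat_semigroup_sup_bound\<close> for \<open>q = \<infinity>\<close>).

  Part (2). Writing the semigroup as \<open>exp (- 2 t)\<close> times a power series in \<open>t\<close> shows that it
  solves the heat equation, so that every time derivative is two spatial differences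
  (\<open>higher_deriv_heat\<close>) and the claim becomes \<open>\<delta>\<^sup>M exp(t \<Delta>) f(n) \<longlongrightarrow> 0\<close> for \<open>M = m + 2 l > \<alpha>\<close>.
  For \<open>q < \<infinity>\<close> the inequality \<open>x \<le> 1 + x\<^sup>q\<close>, applied to the weighted data, splits \<open>f\<close> into a part bounded by
  \<open>(1 + \<bar>j\<bar>)\<^sup>\<alpha>\<close> and a part bounded by \<open>(1 + \<bar>j\<bar>)\<^sup>\<alpha>\<^sup>+\<^sup>1 h(j)\<close> with \<open>h\<close> summable; for
  \<open>q = \<infinity>\<close> the first part is all there is. Against the first
  part the \<open>\<ell>\<^sup>1\<close> bound is used and against the second the supremum bound; both contribute
  \<open>s\<close> to the power \<open>\<alpha> - M\<close> (\<open>delta_heat_semigroup_le\<close>).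
\<close>

section \<open>Sums and elementary inequalities\<close>

lemma has_sum_int_from_nat:
  fixes g :: "int \<Rightarrow> 'a :: {comm_monoid_add, topological_space}"
  assumes "((\<lambda>k. g (int k)) has_sum S) UNIV" and "\<And>i. i < 0 \<Longrightarrow> g i = 0"
  shows "(g has_sum S) UNIV"
proof -
  have "(g has_sum S) (range int)"
    using assms(1) by (subst has_sum_reindex) (auto simp: o_def)
  moreover have "g i = 0" if "i \<notin> range int" for i
    using assms(2)[of i] that by (metis nat_0_le not_le rangeI)
  ultimately show ?thesis
    by (subst (asm) has_sum_cong_neutral[where T = UNIV and g = g]) auto
qed

lemma nonneg_sums_bounded:
  fixes g :: "'a \<Rightarrow> real"
  assumes "\<And>x. 0 \<le> g x" "\<And>F. finite F \<Longrightarrow> sum g F \<le> B"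
  shows "g summable_on UNIV" "infsum g UNIV \<le> B"
proof -
  show "g summable_on UNIV"
    by (rule nonneg_bdd_above_summable_on) (use assms in \<open>auto intro!: bdd_aboveI[of _ B]\<close>)
  then show "infsum g UNIV \<le> B"
    by (rule infsum_le_finite_sums) (use assms in auto)
qed

text \<open>
  The half of Tonelli's theorem that suffices for bounding double sums: the outer sum stays
  finite, so that it may be exchanged with the inner one by additivity alone.
\<close>
lemma sum_infsum_le:
  fixes a :: "'a \<Rightarrow> 'b \<Rightarrow> real"
  assumes "finite F" "\<And>n. n \<in> F \<Longrightarrow> a n summable_on UNIV"
    and "\<And>i. (\<Sum>n\<in>F. a n i) \<le> b i" "b summable_on UNIV"
  shows "(\<Sum>n\<in>F. infsum (a n) UNIV) \<le> infsum b UNIV"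
proof -
  have "((\<lambda>i. \<Sum>n\<in>F. a n i) has_sum (\<Sum>n\<in>F. infsum (a n) UNIV)) UNIV"
    using assms(1,2) by (induction F rule: finite_induct) (auto intro!: has_sum_add)
  then show ?thesis
    by (rule has_sum_mono[OF _ has_sum_infsum[OF assms(4)]]) (rule assms(3))
qed

lemma sum_convolution_weight_le:
  fixes G :: "int \<Rightarrow> real"
  assumes "finite F" "\<And>F. finite F \<Longrightarrow> (\<Sum>k\<in>F. G k * w k) \<le> B"
  shows "(\<Sum>n\<in>F. G (n - j) * w (n - j)) \<le> B"
    and "(\<Sum>j\<in>F. G (n - j) * w (n - j)) \<le> B"
proof -
  have "(\<Sum>m\<in>F. G (e m) * w (e m)) \<le> B" if "inj e" for e :: "int \<Rightarrow> int"
  proof -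
    have "(\<Sum>m\<in>F. G (e m) * w (e m)) = (\<Sum>k\<in>e ` F. G k * w k)"
      using that by (subst sum.reindex) (auto simp: inj_on_def)
    then show ?thesis using assms by simp
  qed
  then show "(\<Sum>n\<in>F. G (n - j) * w (n - j)) \<le> B" "(\<Sum>j\<in>F. G (n - j) * w (n - j)) \<le> B"
    by (simp_all add: inj_on_def)
qed

lemma power_le_fact_exp:
  fixes x :: real assumes "x \<ge> 0" shows "x ^ n \<le> fact n * exp x"
proof -
  have "(\<Sum>k\<in>{n}. x ^ k /\<^sub>R fact k) \<le> exp x"
    unfolding exp_def using assms by (intro sum_le_suminf summable_exp_generic) auto
  then show ?thesis by (simp add: field_simps)
qed

text \<open>
  Convexity gives \<open>exp x - 1 \<le> x exp x\<close>, hence \<open>exp x - 1 - x \<le> x (exp x - 1)\<close>, and the last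
  factor is again of first order in \<open>x\<close>.
\<close>
lemma exp_minus_linear_le: "exp x - 1 - x \<le> x\<^sup>2 * exp \<bar>x\<bar>" for x :: real
proof -
  have b: "exp y - 1 \<le> y * exp y" for y :: real
  proof -
    have "exp y * (1 - y) \<le> exp y * exp (- y)"
      using exp_ge_add_one_self[of "- y"] by (intro mult_left_mono) auto
    also have "\<dots> = 1" by (simp add: exp_add[symmetric])
    finally show ?thesis by (simp add: algebra_simps)
  qed
  show ?thesis
  proof (cases "x \<ge> 0")
    case True
    have "exp x - 1 - x \<le> x * (exp x - 1)" using b[of x] by (simp add: algebra_simps)
    also have "\<dots> \<le> x * (x * exp x)" by (intro mult_left_mono b True)
    finally show ?thesis using True by (simp add: power2_eq_square)
  next
    case False
    have "exp x - 1 - x \<le> (- x) * (1 - exp x)" using b[of x] by (simp add: algebra_simps)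
    also have "\<dots> \<le> (- x) * (- x)"
    proof (rule mult_left_mono)
      show "1 - exp x \<le> - x" using exp_ge_add_one_self[of x] by linarith
    qed (use False in simp)
    also have "\<dots> \<le> x\<^sup>2 * exp \<bar>x\<bar>" by (simp add: power2_eq_square mult_le_cancel_left1)
    finally show ?thesis .
  qed
qed

lemma le_one_plus_powr:
  fixes x r :: real assumes "x \<ge> 0" "r \<ge> 1" shows "x \<le> 1 + x powr r"
proof (cases "x \<le> 1")
  case False
  then have "x powr 1 \<le> x powr r" using assms by (intro powr_mono) auto
  then show ?thesis using assms by simp
qed (simp add: add_increasing2)

lemma one_plus_powr_le:
  fixes x a :: real assumes "x \<ge> 0" "a \<ge> 0"
  shows "(1 + x) powr a \<le> 2 powr a * (1 + x powr a)"
proof -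
  have "(1 + x) powr a \<le> (2 * max 1 x) powr a" using assms by (intro powr_mono2) auto
  also have "\<dots> = 2 powr a * max 1 x powr a" by (simp add: powr_mult)
  also have "max 1 x powr a \<le> 1 + x powr a" by (simp add: max_def)
  finally show ?thesis by simp
qed

lemma one_plus_powr_ge:
  fixes x a :: real assumes "x \<ge> 0" "a \<ge> 0"
  shows "1 + x powr a \<le> 2 * (1 + x) powr a"
proof -
  have "x powr a \<le> (1 + x) powr a" "1 \<le> (1 + x) powr a"
    using assms by (auto intro!: powr_mono2 ge_one_powr_ge_zero)
  then show ?thesis by simp
qed

text \<open>
  Jensen's inequality up to a constant, for weights of total mass at most \<open>c\<close>. The pointwise
  inequality \<open>x \<le> A + A powr (1 - r) * x powr r\<close> holds for every \<open>A > 0\<close>; it is summed, and then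
  \<open>A\<close> is optimised.
\<close>
lemma powr_infsum_le:
  fixes w v :: "'a \<Rightarrow> real"
  assumes r: "r \<ge> 1" and w: "\<And>j. 0 \<le> w j" "w summable_on UNIV" "infsum w UNIV \<le> c"
    and v: "\<And>j. 0 \<le> v j" "(\<lambda>j. w j * v j) summable_on UNIV" "(\<lambda>j. w j * v j powr r) summable_on UNIV"
  shows "(\<Sum>\<^sub>\<infinity>j\<in>UNIV. w j * v j) powr r \<le> (c + 1) powr r * (\<Sum>\<^sub>\<infinity>j\<in>UNIV. w j * v j powr r)"
proof -
  define L where "L = (\<Sum>\<^sub>\<infinity>j\<in>UNIV. w j * v j)"
  define S where "S = (\<Sum>\<^sub>\<infinity>j\<in>UNIV. w j * v j powr r)"
  have L0: "0 \<le> L" and S0: "0 \<le> S" using w v by (auto simp: L_def S_def intro!: infsum_nonneg)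
  have c0: "0 \<le> c" using infsum_nonneg[of UNIV w] w by force
  have key: "L \<le> A * c + A powr (1 - r) * S" if A: "A > 0" for A
  proof -
    have pt: "x \<le> A + A powr (1 - r) * x powr r" if x: "0 \<le> x" for x
    proof (cases "x \<le> A")
      case True
      then show ?thesis using x by (simp add: add_increasing2)
    next
      case False
      then have "x = x powr (1 - r) * x powr r" using A by (simp add: powr_add[symmetric])
      also have "\<dots> \<le> A powr (1 - r) * x powr r"
        using False A r by (intro mult_right_mono powr_mono2') auto
      finally show ?thesis using A by linarith
    qed
    have sm: "(\<lambda>j. A * w j + A powr (1 - r) * (w j * v j powr r)) summable_on UNIV"
      by (intro summable_on_add summable_on_cmult_right w v)
    have "L \<le> (\<Sum>\<^sub>\<infinity>j\<in>UNIV. A * w j + A powr (1 - r) * (w j * v j powr r))"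
      unfolding L_def
    proof (rule infsum_mono[OF v(2) sm])
      fix j
      have "w j * v j \<le> w j * (A + A powr (1 - r) * v j powr r)"
        by (intro mult_left_mono pt w v)
      then show "w j * v j \<le> A * w j + A powr (1 - r) * (w j * v j powr r)"
        by (simp add: algebra_simps)
    qed
    also have "\<dots> = A * infsum w UNIV + A powr (1 - r) * S"
      unfolding S_def using w v
      by (simp add: infsum_add summable_on_cmult_right infsum_cmult_right)
    also have "\<dots> \<le> A * c + A powr (1 - r) * S" using w A by simp
    finally show ?thesis .
  qed
  have "L \<le> (c + 1) * S powr (1 / r)"
  \<comment> \<open>The choice \<open>A = S powr (1 / r)\<close> balances the two terms; if \<open>S = 0\<close>, then \<open>A\<close> tends to \<open>0\<close> instead.\<close>
  proof (cases "S = 0")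
    case True
    have "L \<le> 0 + e" if "e > 0" for e
    proof -
      have "L \<le> e / (c + 1) * c" using key[of "e / (c + 1)"] that c0 True by simp
      also have "\<dots> \<le> e" using that c0 by (simp add: field_simps)
      finally show ?thesis by simp
    qed
    then have "L \<le> 0" by (rule field_le_epsilon)
    then show ?thesis using True by simp
  next
    case False
    then have S: "S > 0" using S0 by simp
    have "(S powr (1 / r)) powr (1 - r) * S = S powr (1 / r)"
    proof -
      have "(S powr (1 / r)) powr (1 - r) * S = S powr ((1 - r) / r) * S powr 1"
        using S by (simp add: powr_powr)
      also have "\<dots> = S powr ((1 - r) / r + 1)" by (simp only: powr_add)
      also have "(1 - r) / r + 1 = 1 / r" using r by (simp add: field_simps)
      finally show ?thesis .
    qed
    then show ?thesis using key[of "S powr (1 / r)"] S by (simp add: algebra_simps)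
  qed
  then have "L powr r \<le> ((c + 1) * S powr (1 / r)) powr r"
    using L0 r by (intro powr_mono2) auto
  also have "\<dots> = (c + 1) powr r * S"
    using c0 S0 r by (simp add: powr_mult powr_powr)
  finally show ?thesis unfolding L_def S_def .
qed

section \<open>Poisson weights and their exponential moments\<close>

text \<open>
  Poisson weights, extended by zero to the negative integers. The index is an integer so that
  translations and reflections of the index need no case distinction.
\<close>
definition pois :: "real \<Rightarrow> int \<Rightarrow> real" where
  "pois t i = (if i < 0 then 0 else exp (- t) * t ^ nat i / fact (nat i))"

lemma pois_nonneg: "t \<ge> 0 \<Longrightarrow> 0 \<le> pois t i"
  by (simp add: pois_def)

lemma pois_of_nat: "pois t (int k) = exp (- t) * t ^ k / fact k"
  by (simp add: pois_def)

lemma pois_rec: "real_of_int i * pois t i = t * pois t (i - 1)"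
proof (cases "i \<le> 0")
  case False
  then obtain k where k: "i = int (Suc k)"
    by (metis not_less zero_less_imp_eq_int not0_implies_Suc of_nat_0 order_refl)
  have "i - 1 = int k" using k by simp
  then show ?thesis
    unfolding \<open>i - 1 = int k\<close> unfolding k pois_of_nat by (simp add: divide_simps)
qed (auto simp: pois_def)

lemma pois_exp_has_sum:
  assumes "t \<ge> 0"
  shows "((\<lambda>i. pois t i * exp (c * real_of_int i)) has_sum exp (t * (exp c - 1))) UNIV"
proof (rule has_sum_int_from_nat)
  have eq: "pois t (int k) * exp (c * real_of_int (int k)) = exp (- t) * ((t * exp c) ^ k /\<^sub>R fact k)" for k
    by (simp add: pois_of_nat exp_of_nat_mult[symmetric] power_mult_distrib field_simps)
  have "(\<lambda>k. exp (- t) * ((t * exp c) ^ k /\<^sub>R fact k)) sums (exp (- t) * exp (t * exp c))"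
    by (intro sums_mult exp_converges)
  also have "exp (- t) * exp (t * exp c) = exp (t * (exp c - 1))"
    by (simp add: exp_add[symmetric] algebra_simps)
  finally have "(\<lambda>k. pois t (int k) * exp (c * real_of_int (int k))) sums exp (t * (exp c - 1))"
    unfolding eq .
  then show "((\<lambda>k. pois t (int k) * exp (c * real_of_int (int k))) has_sum exp (t * (exp c - 1))) UNIV"
    by (rule sums_nonneg_imp_has_sum) (simp add: pois_nonneg assms)
qed (simp add: pois_def)

lemma pois_has_sum: "t \<ge> 0 \<Longrightarrow> (pois t has_sum 1) UNIV"
  using pois_exp_has_sum[of t 0] by simp

lemma pois_le_1:
  assumes "t \<ge> 0" shows "pois t i \<le> 1"
  using finite_sum_le_has_sum[OF pois_has_sum[OF assms], of "{i}"] by (simp add: pois_nonneg assms)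

text \<open>
  The Laplace transform about the mean \<open>t\<close>. Its exponent is of second order in \<open>x\<close>, so that it
  stays bounded as long as \<open>x\<close> is of order \<open>1 / sqrt t\<close>.
\<close>
lemma pois_exp_centered:
  assumes "t > 0" "x\<^sup>2 * t \<le> b" "\<bar>x\<bar> \<le> c"
  shows "((\<lambda>i. pois t i * exp (x * (real_of_int i - t))) has_sum exp (t * (exp x - 1 - x))) UNIV"
    and "exp (t * (exp x - 1 - x)) \<le> exp (b * exp c)"
proof -
  have "((\<lambda>i. pois t i * exp (x * real_of_int i) * exp (- (x * t))) has_sum
      (exp (t * (exp x - 1)) * exp (- (x * t)))) UNIV"
    using assms by (intro has_sum_cmult_left pois_exp_has_sum) auto
  then show "((\<lambda>i. pois t i * exp (x * (real_of_int i - t))) has_sum exp (t * (exp x - 1 - x))) UNIV"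
    by (simp add: mult.assoc exp_add[symmetric] algebra_simps)
  have "t * (exp x - 1 - x) \<le> t * (x\<^sup>2 * exp \<bar>x\<bar>)"
    using assms exp_minus_linear_le by (intro mult_left_mono) auto
  also have "\<dots> = (x\<^sup>2 * t) * exp \<bar>x\<bar>" by simp
  also have "\<dots> \<le> b * exp c"
    using assms by (intro mult_mono) (auto intro: order_trans[of 0 "x\<^sup>2 * t"])
  finally show "exp (t * (exp x - 1 - x)) \<le> exp (b * exp c)" by simp
qed

text \<open>
  The length scale \<open>sqrt t\<close> of the diffusion, but never less than the lattice spacing: the tails
  of the kernel for small \<open>t\<close> are not claimed to decay faster than \<open>exp (- \<bar>n\<bar>)\<close>, and in return one
  scale serves all \<open>t > 0\<close>.
\<close>
definition width :: "real \<Rightarrow> real" where "width t = sqrt (1 + t)"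

lemma width_ge_1: "t > 0 \<Longrightarrow> width t \<ge> 1"
  and width_sq: "t > 0 \<Longrightarrow> (width t)\<^sup>2 = 1 + t"
  by (auto simp: width_def)

text \<open>
  Poisson weights concentrate about \<open>t\<close> at scale \<open>width t\<close> with exponential tails, uniformly in
  \<open>t\<close>: dominate the exponential of the absolute value by the sum of the two one-sided ones.
\<close>
lemma pois_exp_abs_sum_le:
  assumes "t > 0" "c \<ge> 0" "finite F"
  shows "(\<Sum>i\<in>F. pois t i * exp (c * \<bar>real_of_int i - t\<bar> / width t)) \<le> 2 * exp (c\<^sup>2 * exp c)"
proof -
  define x where "x = c / width t"
  note w = width_ge_1[OF assms(1)] width_sq[OF assms(1)]
  have x: "x\<^sup>2 * t \<le> c\<^sup>2" "0 \<le> x" "x \<le> c"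
  proof -
    have "x\<^sup>2 * t = c\<^sup>2 * (t / (1 + t))" by (simp add: x_def power_divide w)
    also have "\<dots> \<le> c\<^sup>2" using assms by (intro mult_left_le) auto
    finally show "x\<^sup>2 * t \<le> c\<^sup>2" .
    show "0 \<le> x" "x \<le> c" using assms w by (auto simp: x_def divide_le_eq mult_le_cancel_left1)
  qed
  have le: "(\<Sum>i\<in>F. pois t i * exp (y * (real_of_int i - t))) \<le> exp (c\<^sup>2 * exp c)"
    if "y\<^sup>2 = x\<^sup>2" for y
  proof -
    have y: "y\<^sup>2 * t \<le> c\<^sup>2" "\<bar>y\<bar> \<le> c" using x that by (auto simp: power2_eq_iff)
    have "(\<Sum>i\<in>F. pois t i * exp (y * (real_of_int i - t))) \<le> exp (t * (exp y - 1 - y))"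
      by (rule finite_sum_le_has_sum[OF pois_exp_centered(1)[OF assms(1) y] assms(3)])
        (use assms(1) in \<open>auto simp: pois_nonneg\<close>)
    also have "\<dots> \<le> exp (c\<^sup>2 * exp c)"
      by (rule pois_exp_centered(2)[OF assms(1) y])
    finally show ?thesis .
  qed
  have "(\<Sum>i\<in>F. pois t i * exp (c * \<bar>real_of_int i - t\<bar> / width t)) \<le>
      (\<Sum>i\<in>F. pois t i * exp (x * (real_of_int i - t)) + pois t i * exp ((- x) * (real_of_int i - t)))"
  proof (rule sum_mono)
    fix i
    have "exp (c * \<bar>real_of_int i - t\<bar> / width t) \<le> exp (x * (real_of_int i - t)) + exp ((- x) * (real_of_int i - t))"
    proof (cases "real_of_int i \<ge> t")
      case False
      then have "c * \<bar>real_of_int i - t\<bar> / width t = (- x) * (real_of_int i - t)"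
        by (simp add: x_def algebra_simps diff_divide_distrib)
      then show ?thesis by simp
    qed (simp add: x_def)
    then show "pois t i * exp (c * \<bar>real_of_int i - t\<bar> / width t) \<le>
      pois t i * exp (x * (real_of_int i - t)) + pois t i * exp ((- x) * (real_of_int i - t))"
      unfolding distrib_left[symmetric] using assms by (intro mult_left_mono pois_nonneg) auto
  qed
  also have "\<dots> \<le> exp (c\<^sup>2 * exp c) + exp (c\<^sup>2 * exp c)"
    unfolding sum.distrib by (intro add_mono le) auto
  finally show ?thesis by simp
qed

section \<open>Iterated differences\<close>

definition delta_left :: "(int \<Rightarrow> real) \<Rightarrow> int \<Rightarrow> real" where
  "delta_left g i = g i - g (i - 1)"

lemma funpow_delta_Suc:
  "(delta_right ^^ Suc m) g n = (delta_right ^^ m) g n - (delta_right ^^ m) g (n + 1)"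
  unfolding funpow.simps(2) o_apply delta_right_def ..

lemma funpow_delta_right_infsum:
  assumes "\<And>n. (\<lambda>i. a i n) summable_on UNIV"
  shows "(\<lambda>i. (delta_right ^^ M) (a i) n) summable_on UNIV"
    and "(delta_right ^^ M) (\<lambda>n. \<Sum>\<^sub>\<infinity>i\<in>UNIV. a i n) n = (\<Sum>\<^sub>\<infinity>i\<in>UNIV. (delta_right ^^ M) (a i) n)"
proof (induction M arbitrary: n)
  case (Suc M)
  have diff: "((\<lambda>i. (delta_right ^^ Suc M) (a i) n) has_sum
      (\<Sum>\<^sub>\<infinity>i\<in>UNIV. (delta_right ^^ M) (a i) n) - (\<Sum>\<^sub>\<infinity>i\<in>UNIV. (delta_right ^^ M) (a i) (n + 1))) UNIV" for n
    using has_sum_add[OF has_sum_infsum[OF Suc.IH(1)[of n]] has_sum_uminusI[OF has_sum_infsum[OF Suc.IH(1)[of "n + 1"]]]]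
    unfolding funpow_delta_Suc by simp
  {
    case 1
    show ?case using diff by (rule has_sum_imp_summable)
  next
    case 2
    have "(delta_right ^^ M) (\<lambda>n. \<Sum>\<^sub>\<infinity>i\<in>UNIV. a i n) = (\<lambda>n. \<Sum>\<^sub>\<infinity>i\<in>UNIV. (delta_right ^^ M) (a i) n)"
      using Suc.IH(2) by blast
    then show ?case by (subst diff[THEN infsumI]) (simp only: funpow_delta_Suc)
  }
qed (use assms in auto)

lemma funpow_delta_right_reflect:
  "(delta_right ^^ M) (\<lambda>n. g (i - n) * c) n = (delta_left ^^ M) g (i - n) * c"
  by (induction M arbitrary: n) (simp_all add: delta_right_def delta_left_def algebra_simps)

lemma funpow_delta_right_shift:
  "(delta_right ^^ M) (\<lambda>n. g (n - j) * c) n = (delta_right ^^ M) g (n - j) * c"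
  by (induction M arbitrary: n) (simp_all add: delta_right_def algebra_simps)

section \<open>Differences of Poisson weights\<close>

text \<open>
  For \<open>M = 0\<close> this is \<open>i p\<^sub>t(i) = t p\<^sub>t(i - 1)\<close>; each backward difference of the identity
  produces, by the Leibniz rule for the factor \<open>t - i\<close>, one more copy of the last term. This is the
  recursion of the Charlier polynomials.
\<close>
lemma delta_left_pois_rec:
  "t * (delta_left ^^ Suc M) (pois t) i =
    (t - real_of_int i) * (delta_left ^^ M) (pois t) i
      - real M * (delta_left ^^ (M - 1)) (pois t) (i - 1)"
proof (induction M arbitrary: i)
  case 0
  have "(delta_left ^^ Suc 0) (pois t) i = pois t i - pois t (i - 1)" by (simp add: delta_left_def)
  then have "t * (delta_left ^^ Suc 0) (pois t) i = t * pois t i - t * pois t (i - 1)"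
    by (metis right_diff_distrib)
  also have "\<dots> = t * pois t i - real_of_int i * pois t i" by (simp only: pois_rec)
  finally show ?case by (simp add: left_diff_distrib del: funpow.simps(2))
next
  case (Suc M)
  let ?q = "\<lambda>M. (delta_left ^^ M) (pois t)"
  have step: "?q (Suc K) j = ?q K j - ?q K (j - 1)" for K j
    unfolding funpow.simps(2) o_apply delta_left_def ..
  have c: "real M * (?q (M - 1) (i - 1) - ?q (M - 1) (i - 2)) = real M * ?q M (i - 1)"
  proof (cases M)
    case (Suc K)
    then show ?thesis using step[of K "i - 1"] by (simp del: funpow.simps)
  qed simp
  have "t * ?q (Suc (Suc M)) i = t * ?q (Suc M) i - t * ?q (Suc M) (i - 1)"
    unfolding step[of "Suc M"] right_diff_distrib ..
  also have "\<dots> = (t - real_of_int i) * ?q (Suc M) i - ?q M (i - 1)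
      - real M * (?q (M - 1) (i - 1) - ?q (M - 1) (i - 2))"
  proof -
    have "(t - real_of_int i) * ?q M i = (t - real_of_int i) * ?q (Suc M) i + (t - real_of_int i) * ?q M (i - 1)"
      unfolding step[of M i] by (simp add: algebra_simps)
    then show ?thesis
      unfolding Suc.IH by (simp add: algebra_simps del: funpow.simps)
  qed
  also have "\<dots> = (t - real_of_int i) * ?q (Suc M) i - real (Suc M) * ?q (Suc M - 1) (i - 1)"
    unfolding c by (simp add: algebra_simps del: funpow.simps)
  finally show ?case .
qed

text \<open>
  Each step of the recursion gains \<open>\<bar>i - t\<bar> / t\<close>, which is \<open>1 / width t\<close> times the deviation
  measured in units of \<open>width t\<close>. In the second term of the recursion \<open>p\<^sub>t(i - 1) = (i / t) p\<^sub>t(i)\<close>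
  costs one power of that deviation, and \<open>1 / t\<close> gains two powers of \<open>1 / width t\<close>. The restriction
  \<open>t \<ge> 1\<close> makes \<open>t\<close> comparable to \<open>(width t)\<^sup>2\<close>.
\<close>
lemma delta_left_pois_le:
  "\<exists>C\<ge>0. \<forall>t\<ge>1. \<forall>i. \<bar>(delta_left ^^ M) (pois t) i\<bar>
     \<le> C / width t ^ M * (1 + \<bar>real_of_int i - t\<bar> / width t) ^ M * pois t i"
proof (induction M rule: less_induct)
  case (less M)
  show ?case
  proof (cases M)
    case 0
    then show ?thesis by (intro exI[of _ 1]) (auto simp: pois_nonneg)
  next
    case M: (Suc K)
    let ?q = "\<lambda>M t. (delta_left ^^ M) (pois t)"
    let ?X = "\<lambda>t i. 1 + \<bar>real_of_int i - t\<bar> / width t"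
    obtain C where C: "C \<ge> 0" "\<And>t i. t \<ge> 1 \<Longrightarrow> \<bar>?q K t i\<bar> \<le> C / width t ^ K * ?X t i ^ K * pois t i"
      using less[of K] unfolding M by blast
    obtain D where D: "D \<ge> 0"
      "\<And>t i. t \<ge> 1 \<Longrightarrow> \<bar>?q (K - 1) t i\<bar> \<le> D / width t ^ (K - 1) * ?X t i ^ (K - 1) * pois t i"
      using less[of "K - 1"] unfolding M by (meson diff_le_self le_imp_less_Suc)
    have "\<bar>?q (Suc K) t i\<bar> \<le> (2 * C + 6 * real K * 2 ^ (K - 1) * D) / width t ^ Suc K * ?X t i ^ Suc K * pois t i"
      if t: "t \<ge> 1" for t i
    proof -
      define s where "s = width t"
      define X where "X = ?X t i"
      define Y where "Y = ?X t (i - 1)"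
      define p where "p = pois t i"
      have s: "s \<ge> 1" "s\<^sup>2 \<le> 2 * t"
        using t width_ge_1[of t] width_sq[of t] by (auto simp: s_def)
      have p: "p \<ge> 0" using t by (simp add: p_def pois_nonneg)
      have X: "X \<ge> 1" "\<bar>real_of_int i - t\<bar> \<le> s * X"
        using s by (auto simp: X_def s_def[symmetric] field_simps)
      have Y: "0 \<le> Y" "Y \<le> 2 * X"
      proof -
        have "\<bar>real_of_int (i - 1) - t\<bar> / s \<le> (1 + \<bar>real_of_int i - t\<bar>) / s"
          using s by (intro divide_right_mono) auto
        also have "\<dots> \<le> 1 + \<bar>real_of_int i - t\<bar> / s" using s by (simp add: field_simps)
        finally have le: "\<bar>real_of_int (i - 1) - t\<bar> / s \<le> 1 + \<bar>real_of_int i - t\<bar> / s" .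
        have "1 + u \<le> 2 * (1 + v)" if "u \<le> 1 + v" "0 \<le> v" for u v :: real
          using that by simp
        from this[OF le] show "Y \<le> 2 * X"
          using s by (simp add: X_def Y_def s_def)
        show "0 \<le> Y" using s by (simp add: Y_def s_def[symmetric])
      qed
      have it: "1 / t \<le> 2 / s\<^sup>2" using s t by (simp add: field_simps)
      have a: "\<bar>real_of_int i - t\<bar> / t \<le> 2 / s * X"
      proof -
        have "\<bar>real_of_int i - t\<bar> * (1 / t) \<le> (s * X) * (2 / s\<^sup>2)"
          using X it s t by (intro mult_mono) auto
        then show ?thesis using s by (simp add: power2_eq_square mult.commute)
      qed
      have pp: "pois t (i - 1) \<le> 3 * X * p"
      proof -
        have "real_of_int i / t \<le> 1 + \<bar>real_of_int i - t\<bar> / t"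
          using t by (simp add: field_simps)
        also have "\<dots> \<le> 1 + 2 / s * X" using a by simp
        also have "\<dots> \<le> X + 2 * X"
          using X(1) s(1) by (intro add_mono mult_right_mono) (auto simp: divide_le_eq)
        finally have "real_of_int i / t * p \<le> 3 * X * p" by (intro mult_right_mono p) auto
        moreover have "pois t (i - 1) = real_of_int i / t * p"
          using pois_rec[of i t] t by (simp add: p_def field_simps)
        ultimately show ?thesis by simp
      qed
      have "?q (Suc K) t i = (t * ?q (Suc K) t i) / t" using t by simp
      also have "\<dots> = (t - real_of_int i) / t * ?q K t i - real K * (1 / t * ?q (K - 1) t (i - 1))"
        unfolding delta_left_pois_rec using t by (simp add: field_simps del: funpow.simps)
      also have "\<bar>\<dots>\<bar> \<le> \<bar>(t - real_of_int i) / t * ?q K t i\<bar> + \<bar>real K * (1 / t * ?q (K - 1) t (i - 1))\<bar>"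
        by (rule abs_triangle_ineq4)
      also have "\<dots> = \<bar>real_of_int i - t\<bar> / t * \<bar>?q K t i\<bar> + real K * (1 / t * \<bar>?q (K - 1) t (i - 1)\<bar>)"
        using t by (simp add: abs_mult abs_minus_commute)
      finally have split: "\<bar>?q (Suc K) t i\<bar> \<le> \<dots>" .
      have "\<bar>real_of_int i - t\<bar> / t * \<bar>?q K t i\<bar> \<le> (2 / s * X) * (C / s ^ K * X ^ K * p)"
        using a C(2)[OF t, of i] t X s(1) by (intro mult_mono) (auto simp: s_def X_def p_def)
      also have "\<dots> = 2 * C / s ^ Suc K * X ^ Suc K * p" by simp
      finally have A: "\<bar>real_of_int i - t\<bar> / t * \<bar>?q K t i\<bar> \<le> 2 * C / s ^ Suc K * X ^ Suc K * p" .
      have B: "real K * (1 / t * \<bar>?q (K - 1) t (i - 1)\<bar>)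
          \<le> 6 * real K * 2 ^ (K - 1) * D / s ^ Suc K * X ^ Suc K * p"
      proof (cases K)
        case (Suc J)
        have "\<bar>?q J t (i - 1)\<bar> \<le> D / s ^ J * Y ^ J * pois t (i - 1)"
          using D(2)[OF t, of "i - 1"] Suc by (simp add: s_def Y_def)
        also have "\<dots> \<le> D / s ^ J * (2 * X) ^ J * (3 * X * p)"
          using D(1) Y s pp p X t by (intro mult_mono power_mono) (auto simp: pois_nonneg)
        finally have "1 / t * \<bar>?q J t (i - 1)\<bar> \<le> 2 / s\<^sup>2 * (D / s ^ J * (2 * X) ^ J * (3 * X * p))"
          using it t s by (intro mult_mono) auto
        also have "\<dots> = 6 * 2 ^ J * D / s ^ Suc (Suc J) * X ^ Suc J * p"
          by (simp add: power_mult_distrib power2_eq_square mult_ac)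
        also have "\<dots> \<le> 6 * 2 ^ J * D / s ^ Suc (Suc J) * X ^ Suc (Suc J) * p"
          using X D s p by (intro mult_right_mono mult_left_mono power_increasing) auto
        finally have "real K * (1 / t * \<bar>?q J t (i - 1)\<bar>) \<le>
            real K * (6 * 2 ^ J * D / s ^ Suc (Suc J) * X ^ Suc (Suc J) * p)"
          by (intro mult_left_mono) auto
        then show ?thesis by (simp add: Suc algebra_simps del: funpow.simps power_Suc)
      qed simp
      show ?thesis
        using split A B unfolding X_def[symmetric] unfolding s_def[symmetric] p_def[symmetric]
        by (simp add: add_divide_distrib distrib_right del: funpow.simps power_Suc)
    qed
    then show ?thesis using C(1) D(1) unfolding M
      by (intro exI[of _ "2 * C + 6 * real K * 2 ^ (K - 1) * D"] conjI allI impI) (auto simp del: funpow.simps power_Suc)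
  qed
qed

text \<open>
  The polynomial factor is absorbed into an exponential one, which is the form that the
  correlation estimate below takes.
\<close>
lemma delta_left_pois_exp_le:
  "\<exists>C\<ge>0. \<forall>t\<ge>1. \<forall>i. \<bar>(delta_left ^^ M) (pois t) i\<bar>
     \<le> C / width t ^ M * exp (\<bar>real_of_int i - t\<bar> / width t) * pois t i"
proof -
  obtain C where C: "C \<ge> 0" "\<And>t i. t \<ge> 1 \<Longrightarrow> \<bar>(delta_left ^^ M) (pois t) i\<bar>
     \<le> C / width t ^ M * (1 + \<bar>real_of_int i - t\<bar> / width t) ^ M * pois t i"
    using delta_left_pois_le[of M] by blast
  have "\<bar>(delta_left ^^ M) (pois t) i\<bar>
     \<le> (C * fact M * exp 1) / width t ^ M * exp (\<bar>real_of_int i - t\<bar> / width t) * pois t i" if t: "t \<ge> 1" for t i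
  proof -
    have w: "width t \<ge> 1" using t by (intro width_ge_1) simp
    have "(1 + \<bar>real_of_int i - t\<bar> / width t) ^ M \<le> fact M * exp (1 + \<bar>real_of_int i - t\<bar> / width t)"
      using w by (intro power_le_fact_exp) auto
    then have "C / width t ^ M * (1 + \<bar>real_of_int i - t\<bar> / width t) ^ M * pois t i
       \<le> C / width t ^ M * (fact M * exp (1 + \<bar>real_of_int i - t\<bar> / width t)) * pois t i"
      using C(1) w t by (intro mult_right_mono mult_left_mono) (auto simp: pois_nonneg)
    with C(2)[OF t, of i] show ?thesis by (simp add: exp_add mult_ac)
  qed
  then show ?thesis using C(1) by (intro exI[of _ "C * fact M * exp 1"]) auto
qed

section \<open>Weighted bounds for the heat kernel and its differences\<close>

text \<open>
  In the Bessel series the reciprocal Gamma function vanishes exactly where the Poisson weight of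
  index \<open>k + n\<close> does, so that the two series agree term by term for every sign of \<open>n\<close>.
\<close>
lemma heat_kernel_has_sum:
  assumes "t > 0"
  shows "((\<lambda>i. pois t (i - n) * pois t i) has_sum heat_kernel t n) UNIV"
proof -
  define T where "T k = (2 * t / 2) powi (2 * int k + n) * rGamma (of_int (int k + n + 1)) / fact k" for k
  have T: "exp (- 2 * t) * T k = pois t (int k) * pois t (int k + n)" for k
  proof (cases "int k + n < 0")
    case True
    then show ?thesis by (simp add: T_def pois_def rGamma_of_int del: of_int_add)
  next
    case False
    then obtain m where m: "int k + n = int m" by (metis nonneg_int_cases not_less)
    have "2 * int k + n = int (k + m)" using m by simp
    then have p: "(2 * t / 2) powi (2 * int k + n) = t ^ (k + m)"
      by (simp add: power_int_def del: of_nat_add)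
    have "rGamma (real_of_int (int k + n + 1)) = 1 / fact m"
      unfolding m using rGamma_of_int[of "int m + 1", where 'a = real] by (simp add: field_simps)
    with p have "T k = t ^ (k + m) / fact m / fact k"
      unfolding T_def by simp
    then show ?thesis
      unfolding m pois_of_nat by (simp add: power_add exp_add[symmetric] field_simps)
  qed
  have nn: "0 \<le> pois t i" "pois t i \<le> 1" for i
    using assms pois_nonneg pois_le_1 by auto
  have s0: "(\<lambda>i. pois t i * pois t (i + n)) summable_on UNIV"
    by (rule summable_on_comparison_test[of "pois t"])
       (use pois_has_sum[of t] assms nn in \<open>auto simp: summable_on_def intro!: mult_left_le\<close>)
  have "(\<lambda>k. pois t (int k) * pois t (int k + n)) summable_on UNIV"
    using summable_on_subset_banach[OF s0 subset_UNIV, of "range int"]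
    by (subst (asm) summable_on_reindex) (auto simp: o_def)
  then have hs: "((\<lambda>k. pois t (int k) * pois t (int k + n)) has_sum
      (\<Sum>k. pois t (int k) * pois t (int k + n))) UNIV"
    using has_sum_imp_sums[OF has_sum_infsum] sums_unique has_sum_infsum by fastforce
  have sm: "summable T"
  proof -
    have "summable (\<lambda>k. exp (2 * t) * (exp (- 2 * t) * T k))"
      unfolding T using hs has_sum_imp_sums sums_summable by (intro summable_mult) blast
    then show ?thesis by (simp add: mult.assoc[symmetric] exp_add[symmetric])
  qed
  have "(\<Sum>k. pois t (int k) * pois t (int k + n)) = heat_kernel t n"
    unfolding T[symmetric] heat_kernel_def bessel_I_def T_def[symmetric]
    by (rule suminf_mult[OF sm])
  with hs have "((\<lambda>i. pois t i * pois t (i + n)) has_sum heat_kernel t n) UNIV"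
    by (intro has_sum_int_from_nat) (auto simp: pois_def)
  moreover have "bij_betw (\<lambda>i. i - n) UNIV UNIV"
    by (rule bij_betwI[of _ _ _ "\<lambda>i. i + n"]) auto
  ultimately show ?thesis
    using has_sum_reindex_bij_betw[of "\<lambda>i. i - n" UNIV UNIV "\<lambda>i. pois t i * pois t (i + n)"] by simp
qed

text \<open>
  The mean \<open>t\<close> cancels in a correlation: \<open>\<bar>n\<bar> \<le> \<bar>(i - n) - t\<bar> + \<bar>i - t\<bar>\<close>, so that the weight in \<open>n\<close>
  splits into one exponential weight for each factor, and the double sum into a product.
\<close>
lemma pois_correlation_weighted_sum_le:
  assumes t: "t > 0" and "A \<ge> 0"
    and w: "\<And>j. \<bar>w j\<bar> \<le> A * exp (\<bar>real_of_int j - t\<bar> / width t) * pois t j"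
  shows "(\<lambda>i. w (i - n) * pois t i) summable_on UNIV"
    and "finite F \<Longrightarrow> (\<Sum>n\<in>F. \<bar>\<Sum>\<^sub>\<infinity>i\<in>UNIV. w (i - n) * pois t i\<bar> * exp (\<bar>real_of_int n\<bar> / width t))
           \<le> A * (4 * exp (exp 1 + 4 * exp 2))"
proof -
  define s where "s = width t"
  have s: "s \<ge> 1" using width_ge_1[OF t] by (simp add: s_def)
  note w' = w[folded s_def]
  note tail = pois_exp_abs_sum_le[OF t, folded s_def]
  have p0: "0 \<le> pois t i" for i using t by (simp add: pois_nonneg)
  have nn: "0 \<le> pois t i * exp (c * \<bar>real_of_int i - t\<bar> / s)" for i c by (simp add: p0)
  have wb: "\<bar>w j\<bar> \<le> A * (2 * exp (exp 1))" for j
    using tail[of 1 "{j}"] w'[of j] \<open>A \<ge> 0\<close>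
    by (auto simp: mult_ac intro: order_trans mult_left_mono)
  have ps: "pois t summable_on UNIV" using pois_has_sum[of t] t by (auto simp: summable_on_def)
  have abs_sum: "(\<lambda>i. \<bar>w (i - n) * pois t i\<bar>) summable_on UNIV" for n
    by (rule summable_on_comparison_test[OF summable_on_cmult_right[OF ps, of "A * (2 * exp (exp 1))"]])
       (use wb p0 in \<open>auto simp: abs_mult intro!: mult_right_mono\<close>)
  show "(\<lambda>i. w (i - n) * pois t i) summable_on UNIV"
    using abs_sum[of n] by (subst summable_on_iff_abs_summable_on_real) simp
  assume F: "finite F"
  define b where "b i = A * (2 * exp (4 * exp 2)) * (pois t i * exp (1 * \<bar>real_of_int i - t\<bar> / s))" for i
  have b1: "(\<lambda>i. pois t i * exp (1 * \<bar>real_of_int i - t\<bar> / s)) summable_on UNIV"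
    "(\<Sum>\<^sub>\<infinity>i\<in>UNIV. pois t i * exp (1 * \<bar>real_of_int i - t\<bar> / s)) \<le> 2 * exp (exp 1)"
    using nonneg_sums_bounded[of "\<lambda>i. pois t i * exp (1 * \<bar>real_of_int i - t\<bar> / s)", OF nn, of "2 * exp (exp 1)"]
      tail[of 1] by auto
  have b: "b summable_on UNIV"
    unfolding b_def by (intro summable_on_cmult_right b1)
  have "infsum b UNIV = A * (2 * exp (4 * exp 2)) * (\<Sum>\<^sub>\<infinity>i\<in>UNIV. pois t i * exp (1 * \<bar>real_of_int i - t\<bar> / s))"
    unfolding b_def by (intro infsum_cmult_right b1)
  also have "\<dots> \<le> A * (2 * exp (4 * exp 2)) * (2 * exp (exp 1))"
    using b1(2) \<open>A \<ge> 0\<close> by (intro mult_left_mono) auto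
  also have "\<dots> = A * (4 * exp (exp 1 + 4 * exp 2))" by (simp add: exp_add)
  finally have bb: "infsum b UNIV \<le> A * (4 * exp (exp 1 + 4 * exp 2))" .
  have "(\<Sum>n\<in>F. \<bar>\<Sum>\<^sub>\<infinity>i\<in>UNIV. w (i - n) * pois t i\<bar> * exp (\<bar>real_of_int n\<bar> / s)) \<le>
      (\<Sum>n\<in>F. \<Sum>\<^sub>\<infinity>i\<in>UNIV. \<bar>w (i - n) * pois t i\<bar> * exp (\<bar>real_of_int n\<bar> / s))"
  proof (rule sum_mono)
    fix n
    have "\<bar>\<Sum>\<^sub>\<infinity>i\<in>UNIV. w (i - n) * pois t i\<bar> \<le> (\<Sum>\<^sub>\<infinity>i\<in>UNIV. \<bar>w (i - n) * pois t i\<bar>)"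
      using norm_infsum_bound[of "\<lambda>i. w (i - n) * pois t i" UNIV] abs_sum[of n] by simp
    then show "\<bar>\<Sum>\<^sub>\<infinity>i\<in>UNIV. w (i - n) * pois t i\<bar> * exp (\<bar>real_of_int n\<bar> / s) \<le>
        (\<Sum>\<^sub>\<infinity>i\<in>UNIV. \<bar>w (i - n) * pois t i\<bar> * exp (\<bar>real_of_int n\<bar> / s))"
      by (subst infsum_cmult_left) (auto intro: abs_sum mult_right_mono)
  qed
  also have "\<dots> \<le> infsum b UNIV"
  proof (rule sum_infsum_le[OF F _ _ b])
    show "(\<lambda>i. \<bar>w (i - n) * pois t i\<bar> * exp (\<bar>real_of_int n\<bar> / s)) summable_on UNIV" for n
      by (intro summable_on_cmult_left abs_sum)
    fix i
    let ?h = "\<lambda>j. pois t j * exp (2 * \<bar>real_of_int j - t\<bar> / s)"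
    have "\<bar>w (i - n) * pois t i\<bar> * exp (\<bar>real_of_int n\<bar> / s) \<le>
        A * ?h (i - n) * (pois t i * exp (1 * \<bar>real_of_int i - t\<bar> / s))" for n
    proof -
      have "\<bar>real_of_int n\<bar> \<le> \<bar>real_of_int (i - n) - t\<bar> + \<bar>real_of_int i - t\<bar>" by simp
      then have "\<bar>real_of_int n\<bar> / s \<le> \<bar>real_of_int (i - n) - t\<bar> / s + \<bar>real_of_int i - t\<bar> / s"
        using s by (simp add: divide_right_mono add_divide_distrib[symmetric])
      then have "exp (\<bar>real_of_int n\<bar> / s) \<le> exp (\<bar>real_of_int (i - n) - t\<bar> / s) * exp (\<bar>real_of_int i - t\<bar> / s)"
        by (simp add: exp_add[symmetric])
      then have "\<bar>w (i - n)\<bar> * pois t i * exp (\<bar>real_of_int n\<bar> / s) \<le>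
          (A * exp (\<bar>real_of_int (i - n) - t\<bar> / s) * pois t (i - n)) * pois t i *
          (exp (\<bar>real_of_int (i - n) - t\<bar> / s) * exp (\<bar>real_of_int i - t\<bar> / s))"
        using w'[of "i - n"] p0 \<open>A \<ge> 0\<close> by (intro mult_mono) auto
      also have "\<dots> = A * pois t (i - n) * (exp (\<bar>real_of_int (i - n) - t\<bar> / s) * exp (\<bar>real_of_int (i - n) - t\<bar> / s))
          * (pois t i * exp (\<bar>real_of_int i - t\<bar> / s))" by (simp only: mult_ac)
      also have "exp (\<bar>real_of_int (i - n) - t\<bar> / s) * exp (\<bar>real_of_int (i - n) - t\<bar> / s) =
          exp (2 * \<bar>real_of_int (i - n) - t\<bar> / s)"
        by (simp add: exp_add[symmetric])
      finally show ?thesis using p0[of i] by (simp add: abs_mult mult_ac)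
    qed
    then have "(\<Sum>n\<in>F. \<bar>w (i - n) * pois t i\<bar> * exp (\<bar>real_of_int n\<bar> / s)) \<le>
        (\<Sum>n\<in>F. A * ?h (i - n) * (pois t i * exp (1 * \<bar>real_of_int i - t\<bar> / s)))"
      by (rule sum_mono)
    also have "\<dots> = A * (\<Sum>n\<in>F. ?h (i - n)) * (pois t i * exp (1 * \<bar>real_of_int i - t\<bar> / s))"
      by (simp only: sum_distrib_left sum_distrib_right)
    also have "(\<Sum>n\<in>F. ?h (i - n)) = (\<Sum>j\<in>(\<lambda>n. i - n) ` F. ?h j)"
      by (subst sum.reindex) (auto simp: inj_on_def)
    also have "A * \<dots> * (pois t i * exp (1 * \<bar>real_of_int i - t\<bar> / s)) \<le> b i"
      unfolding b_def
      using tail[of 2 "(\<lambda>n. i - n) ` F"] F \<open>A \<ge> 0\<close> nn[of i 1] by (intro mult_right_mono mult_left_mono) auto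
    finally show "(\<Sum>n\<in>F. \<bar>w (i - n) * pois t i\<bar> * exp (\<bar>real_of_int n\<bar> / s)) \<le> b i" .
  qed
  also note bb
  finally show "(\<Sum>n\<in>F. \<bar>\<Sum>\<^sub>\<infinity>i\<in>UNIV. w (i - n) * pois t i\<bar> * exp (\<bar>real_of_int n\<bar> / width t))
           \<le> A * (4 * exp (exp 1 + 4 * exp 2))"
    unfolding s_def .
qed

lemma funpow_delta_heat_kernel:
  assumes "t > 0"
  shows "(delta_right ^^ M) (heat_kernel t) n = (\<Sum>\<^sub>\<infinity>i\<in>UNIV. (delta_left ^^ M) (pois t) (i - n) * pois t i)"
proof -
  note h = heat_kernel_has_sum[OF assms]
  have "heat_kernel t = (\<lambda>n. \<Sum>\<^sub>\<infinity>i\<in>UNIV. pois t (i - n) * pois t i)"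
    by (rule ext, rule infsumI[OF h, symmetric])
  then show ?thesis
    using funpow_delta_right_infsum(2)[of "\<lambda>i n. pois t (i - n) * pois t i" M n, OF has_sum_imp_summable[OF h]]
    by (simp only: funpow_delta_right_reflect)
qed

lemma heat_kernel_nonneg: "t > 0 \<Longrightarrow> 0 \<le> heat_kernel t n"
  using has_sum_nonneg[OF heat_kernel_has_sum] by (simp add: pois_nonneg)

lemma heat_kernel_weighted_sum_le:
  "\<exists>C>0. \<forall>t>0. \<forall>F. finite F \<longrightarrow> (\<Sum>n\<in>F. heat_kernel t n * exp (\<bar>real_of_int n\<bar> / width t)) \<le> C"
proof (intro exI[of _ "4 * exp (exp 1 + 4 * exp 2)"] conjI allI impI)
  fix t :: real and F :: "int set" assume t: "t > 0" and F: "finite F"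
  have "\<bar>pois t j\<bar> \<le> 1 * exp (\<bar>real_of_int j - t\<bar> / width t) * pois t j" for j
    using width_ge_1[OF t] t pois_nonneg[of t j] by (simp add: mult_le_cancel_right1)
  from pois_correlation_weighted_sum_le(2)[OF t _ this F]
  show "(\<Sum>n\<in>F. heat_kernel t n * exp (\<bar>real_of_int n\<bar> / width t)) \<le> 4 * exp (exp 1 + 4 * exp 2)"
    by (simp add: infsumI[OF heat_kernel_has_sum[OF t]] heat_kernel_nonneg[OF t])
qed simp

lemma delta_heat_kernel_weighted_sum_le:
  "\<exists>C\<ge>0. \<forall>t\<ge>1. \<forall>F. finite F \<longrightarrow>
     (\<Sum>n\<in>F. \<bar>(delta_right ^^ M) (heat_kernel t) n\<bar> * exp (\<bar>real_of_int n\<bar> / width t)) \<le> C / width t ^ M"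
proof -
  obtain C where C: "C \<ge> 0" "\<And>t i. t \<ge> 1 \<Longrightarrow> \<bar>(delta_left ^^ M) (pois t) i\<bar>
     \<le> C / width t ^ M * exp (\<bar>real_of_int i - t\<bar> / width t) * pois t i"
    using delta_left_pois_exp_le[of M] by blast
  show ?thesis
  proof (intro exI[of _ "C * (4 * exp (exp 1 + 4 * exp 2))"] conjI allI impI)
    fix t :: real and F :: "int set" assume t: "t \<ge> 1" and F: "finite F"
    have "0 \<le> C / width t ^ M" using C(1) width_ge_1[of t] t by simp
    from pois_correlation_weighted_sum_le(2)[OF _ this C(2)[OF t] F] t
    show "(\<Sum>n\<in>F. \<bar>(delta_right ^^ M) (heat_kernel t) n\<bar> * exp (\<bar>real_of_int n\<bar> / width t))
        \<le> C * (4 * exp (exp 1 + 4 * exp 2)) / width t ^ M"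
      by (simp add: funpow_delta_heat_kernel)
  qed (use C(1) in simp)
qed

text \<open>
  A summable sequence is the sum of its differences out to infinity. A weight that grows away
  from the origin passes through this sum.
\<close>
lemma weighted_sup_le_difference_sum:
  fixes g :: "int \<Rightarrow> real"
  assumes "g summable_on UNIV" "r \<ge> 0"
    and B: "\<And>F. finite F \<Longrightarrow> (\<Sum>n\<in>F. \<bar>delta_right g n\<bar> * exp (r * \<bar>real_of_int n\<bar>)) \<le> B"
  shows "\<bar>g n\<bar> * exp (r * \<bar>real_of_int n\<bar>) \<le> B"
proof -
  \<comment> \<open>Walk from \<open>n\<close> to infinity on the side away from the origin, where the weight only grows.\<close>
  have main: "\<bar>h 0\<bar> * exp (r * \<bar>real_of_int n\<bar>) \<le> B"
    if inj: "inj e" "inj d" and h: "h = (\<lambda>k. g (e k))"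
      and d: "\<And>k. \<bar>h k - h (Suc k)\<bar> = \<bar>delta_right g (d k)\<bar>"
      and le: "\<And>k. \<bar>n\<bar> \<le> \<bar>d k\<bar>" for e d :: "nat \<Rightarrow> int" and h
  proof -
    have "h summable_on UNIV"
      using summable_on_subset_banach[OF assms(1) subset_UNIV, of "range e"] inj(1)
      unfolding h by (subst (asm) summable_on_reindex) (auto simp: o_def)
    then have lim: "h \<longlonglongrightarrow> 0"
      by (intro summable_LIMSEQ_zero summable_on_imp_summable)
    have "\<bar>h 0\<bar> * exp (r * \<bar>real_of_int n\<bar>) \<le> B + \<bar>h N\<bar> * exp (r * \<bar>real_of_int n\<bar>)" for N
    proof -
      have "h 0 - h N = (\<Sum>k<N. h k - h (Suc k))"
        by (simp add: sum_lessThan_telescope')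
      then have "\<bar>h 0\<bar> \<le> \<bar>\<Sum>k<N. h k - h (Suc k)\<bar> + \<bar>h N\<bar>" by linarith
      also have "\<bar>\<Sum>k<N. h k - h (Suc k)\<bar> \<le> (\<Sum>k<N. \<bar>h k - h (Suc k)\<bar>)" by (rule sum_abs)
      finally have "\<bar>h 0\<bar> * exp (r * \<bar>real_of_int n\<bar>) \<le>
          (\<Sum>k<N. \<bar>h k - h (Suc k)\<bar>) * exp (r * \<bar>real_of_int n\<bar>) + \<bar>h N\<bar> * exp (r * \<bar>real_of_int n\<bar>)"
        by (simp add: distrib_right[symmetric])
      also have "(\<Sum>k<N. \<bar>h k - h (Suc k)\<bar>) * exp (r * \<bar>real_of_int n\<bar>) \<le>
          (\<Sum>k<N. \<bar>delta_right g (d k)\<bar> * exp (r * \<bar>real_of_int (d k)\<bar>))"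
        unfolding sum_distrib_right d
      proof (intro sum_mono mult_left_mono)
        fix k
        have "\<bar>real_of_int n\<bar> \<le> \<bar>real_of_int (d k)\<bar>" using le[of k] by linarith
        then show "exp (r * \<bar>real_of_int n\<bar>) \<le> exp (r * \<bar>real_of_int (d k)\<bar>)"
          using assms(2) by (simp add: mult_left_mono)
      qed simp
      also have "\<dots> = (\<Sum>m\<in>d ` {..<N}. \<bar>delta_right g m\<bar> * exp (r * \<bar>real_of_int m\<bar>))"
        using inj(2) by (subst sum.reindex) (auto simp: inj_on_def)
      also have "\<dots> \<le> B" by (rule B) simp
      finally show ?thesis by simp
    qed
    moreover have "(\<lambda>N. B + \<bar>h N\<bar> * exp (r * \<bar>real_of_int n\<bar>)) \<longlonglongrightarrow> B + \<bar>0\<bar> * exp (r * \<bar>real_of_int n\<bar>)"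
      by (intro tendsto_intros lim)
    ultimately have "\<bar>h 0\<bar> * exp (r * \<bar>real_of_int n\<bar>) \<le> B + \<bar>0\<bar> * exp (r * \<bar>real_of_int n\<bar>)"
      by (intro LIMSEQ_le_const) auto
    then show ?thesis by simp
  qed
  show ?thesis
  proof (cases "n \<ge> 0")
    case True
    show ?thesis
      using main[of "\<lambda>k. n + int k" "\<lambda>k. n + int k" "\<lambda>k. g (n + int k)"] True
      by (simp add: inj_on_def delta_right_def add_ac)
  next
    case False
    show ?thesis
      using main[of "\<lambda>k. n - int k" "\<lambda>k. n - int k - 1" "\<lambda>k. g (n - int k)"] False
      by (simp add: inj_on_def delta_right_def abs_minus_commute diff_diff_add add.commute)
  qed
qed

text \<open>
  The supremum of the \<open>M\<close>-th difference is controlled by the sum of the \<open>(M + 1)\<close>-st, hence the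
  additional power of \<open>width t\<close>.
\<close>
lemma delta_heat_kernel_weighted_sup_le:
  "\<exists>C\<ge>0. \<forall>t\<ge>1. \<forall>n.
     \<bar>(delta_right ^^ M) (heat_kernel t) n\<bar> * exp (\<bar>real_of_int n\<bar> / width t) \<le> C / width t ^ Suc M"
proof -
  obtain C where C: "C \<ge> 0" "\<And>t F. t \<ge> 1 \<Longrightarrow> finite F \<Longrightarrow>
     (\<Sum>n\<in>F. \<bar>(delta_right ^^ Suc M) (heat_kernel t) n\<bar> * exp (\<bar>real_of_int n\<bar> / width t)) \<le> C / width t ^ Suc M"
    using delta_heat_kernel_weighted_sum_le[of "Suc M"] by blast
  obtain D where D: "\<And>t F. t \<ge> 1 \<Longrightarrow> finite F \<Longrightarrow>
     (\<Sum>n\<in>F. \<bar>(delta_right ^^ M) (heat_kernel t) n\<bar> * exp (\<bar>real_of_int n\<bar> / width t)) \<le> D / width t ^ M"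
    using delta_heat_kernel_weighted_sum_le[of "M"] by blast
  have "\<bar>(delta_right ^^ M) (heat_kernel t) n\<bar> * exp (\<bar>real_of_int n\<bar> / width t) \<le> C / width t ^ Suc M"
    if t: "t \<ge> 1" for t n
  proof -
    have w: "width t \<ge> 1" using t by (intro width_ge_1) simp
    have "(\<lambda>n. \<bar>(delta_right ^^ M) (heat_kernel t) n\<bar> * exp (\<bar>real_of_int n\<bar> / width t)) summable_on UNIV"
      by (rule nonneg_sums_bounded[OF _ D[OF t]]) simp
    then have "(\<lambda>n. \<bar>(delta_right ^^ M) (heat_kernel t) n\<bar>) summable_on UNIV"
      by (rule summable_on_comparison_test) (use w in \<open>auto simp: mult_le_cancel_left1\<close>)
    then have "(delta_right ^^ M) (heat_kernel t) summable_on UNIV"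
      by (subst summable_on_iff_abs_summable_on_real) simp
    then show ?thesis
      using weighted_sup_le_difference_sum[of "(delta_right ^^ M) (heat_kernel t)" "1 / width t" "C / width t ^ Suc M" n]
        C(2)[OF t] w by simp
  qed
  then show ?thesis using C(1) by blast
qed

section \<open>Polynomial weights\<close>

text \<open>
  The Japanese bracket \<open>\<langle>n\<rangle>\<close>, in whose powers all polynomial weights are expressed.
\<close>
definition jap :: "int \<Rightarrow> real" where "jap n = 1 + \<bar>real_of_int n\<bar>"

lemma jap_ge_1: "1 \<le> jap n" by (simp add: jap_def)

lemma jap_pos: "0 < jap n" using jap_ge_1[of n] by linarith

lemma jap_peetre: "jap j \<le> jap n * jap (n - j)"
proof -
  have "jap j \<le> 1 + \<bar>real_of_int n\<bar> + \<bar>real_of_int (n - j)\<bar>" by (simp add: jap_def)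
  also have "\<dots> \<le> jap n * jap (n - j)" by (simp add: jap_def algebra_simps)
  finally show ?thesis .
qed

text \<open>
  In units of \<open>s\<close> a power is dominated by an exponential. This turns exponential tails at scale
  \<open>s\<close> into moments with the right power of \<open>s\<close>.
\<close>
lemma jap_powr_le_exp:
  assumes "\<gamma> \<ge> 0"
  shows "\<exists>C>0. \<forall>s\<ge>1. \<forall>k. jap k powr \<gamma> \<le> C * s powr \<gamma> * exp (\<bar>real_of_int k\<bar> / s)"
proof -
  define N where "N = nat \<lceil>\<gamma>\<rceil>"
  have "jap k powr \<gamma> \<le> fact N * exp 1 * s powr \<gamma> * exp (\<bar>real_of_int k\<bar> / s)" if s: "s \<ge> 1" for s k
  proof -
    define x where "x = 1 + \<bar>real_of_int k\<bar> / s"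
    have x: "x \<ge> 1" using s by (simp add: x_def)
    have "jap k \<le> s * x" using s by (simp add: jap_def x_def field_simps)
    then have "jap k powr \<gamma> \<le> (s * x) powr \<gamma>" using jap_pos[of k] assms by (intro powr_mono2) auto
    also have "\<dots> = s powr \<gamma> * x powr \<gamma>" using s x by (simp add: powr_mult)
    finally have le: "jap k powr \<gamma> \<le> s powr \<gamma> * x powr \<gamma>" .
    have "x powr \<gamma> \<le> x powr real N" using x assms by (intro powr_mono) (auto simp: N_def)
    also have "\<dots> = x ^ N" using x by (simp add: powr_realpow)
    also have "\<dots> \<le> fact N * exp x" using x by (intro power_le_fact_exp) auto
    also have "exp x = exp 1 * exp (\<bar>real_of_int k\<bar> / s)" by (simp add: x_def exp_add)
    finally have "s powr \<gamma> * x powr \<gamma> \<le> s powr \<gamma> * (fact N * (exp 1 * exp (\<bar>real_of_int k\<bar> / s)))"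
      by (rule mult_left_mono) simp
    with le show ?thesis by (simp add: mult_ac)
  qed
  then show ?thesis by (intro exI[of _ "fact N * exp 1"]) auto
qed

lemma heat_kernel_moment_le:
  assumes "\<gamma> \<ge> 0"
  shows "\<exists>C>0. \<forall>t>0. \<forall>F. finite F \<longrightarrow> (\<Sum>k\<in>F. heat_kernel t k * jap k powr \<gamma>) \<le> C * width t powr \<gamma>"
proof -
  obtain C where C: "C > 0" "\<And>s k. s \<ge> 1 \<Longrightarrow> jap k powr \<gamma> \<le> C * s powr \<gamma> * exp (\<bar>real_of_int k\<bar> / s)"
    using jap_powr_le_exp[OF assms] by blast
  obtain D where D: "D > 0" "\<And>t F. t > 0 \<Longrightarrow> finite F \<Longrightarrow>
      (\<Sum>n\<in>F. heat_kernel t n * exp (\<bar>real_of_int n\<bar> / width t)) \<le> D"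
    using heat_kernel_weighted_sum_le by blast
  have "(\<Sum>k\<in>F. heat_kernel t k * jap k powr \<gamma>) \<le> C * D * width t powr \<gamma>" if t: "t > 0" and F: "finite F" for t F
  proof -
    have "(\<Sum>k\<in>F. heat_kernel t k * jap k powr \<gamma>) \<le>
        (\<Sum>k\<in>F. heat_kernel t k * (C * width t powr \<gamma> * exp (\<bar>real_of_int k\<bar> / width t)))"
      by (intro sum_mono mult_left_mono C(2) width_ge_1 t heat_kernel_nonneg)
    also have "\<dots> = C * width t powr \<gamma> * (\<Sum>k\<in>F. heat_kernel t k * exp (\<bar>real_of_int k\<bar> / width t))"
      by (simp add: sum_distrib_left mult_ac)
    also have "\<dots> \<le> C * width t powr \<gamma> * D"
      using C(1) by (intro mult_left_mono D t F) auto
    finally show ?thesis by (simp add: mult_ac)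
  qed
  then show ?thesis using C(1) D(1) by (intro exI[of _ "C * D"]) auto
qed

section \<open>The semigroup as a sum over pairs of Poisson indices\<close>

text \<open>
  Summing over the two Poisson indices separately replaces the kernel by explicit terms. This
  form gives both absolute convergence, as the double series is dominated by a product of two
  convergent series, and below the power series in \<open>t\<close>. The exponential growth allowed here exceeds
  every polynomial.
\<close>
lemma pois_pairs_has_sum_heat_semigroup:
  assumes t: "t > 0" and f: "\<And>j. \<bar>f j\<bar> \<le> K * exp \<bar>real_of_int j\<bar>"
  shows "(\<lambda>j. heat_kernel t (n - j) * f j) summable_on UNIV"
    and "((\<lambda>(k, i). pois t k * pois t i * f (n + k - i)) has_sum heat_semigroup t f n) (UNIV \<times> UNIV)"
proof -
  have K: "K \<ge> 0" using order_trans[OF abs_ge_zero f[of 0]] by simp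
  have p0: "0 \<le> pois t k" for k using t by (simp add: pois_nonneg)
  let ?P = "\<lambda>k. pois t k * exp (1 * real_of_int k)"
  obtain P where P: "(?P has_sum P) UNIV" using pois_exp_has_sum[of t 1] t by fastforce
  have Pexp: "pois t k * exp \<bar>real_of_int k\<bar> = ?P k" for k by (simp add: pois_def)
  have sm: "(\<lambda>(k, i). K * exp \<bar>real_of_int n\<bar> * (?P k * ?P i)) summable_on (UNIV \<times> UNIV)"
    by (rule summable_on_SigmaI[where g = "\<lambda>k. K * exp \<bar>real_of_int n\<bar> * (?P k * P)"])
       (use P K p0 in \<open>auto intro!: has_sum_cmult_right summable_on_cmult_right summable_on_cmult_left
          intro: has_sum_imp_summable\<close>)
  let ?h = "\<lambda>(k, i). pois t k * pois t i * f (n + k - i)"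
  have "(\<lambda>x. norm (?h x)) summable_on (UNIV \<times> UNIV)"
  proof (rule summable_on_comparison_test[OF sm])
    fix x :: "int \<times> int"
    obtain k i where x: "x = (k, i)" by fastforce
    have "\<bar>f (n + k - i)\<bar> \<le> K * exp \<bar>real_of_int (n + k - i)\<bar>" by (rule f)
    also have "\<dots> \<le> K * exp (\<bar>real_of_int n\<bar> + \<bar>real_of_int k\<bar> + \<bar>real_of_int i\<bar>)"
      using K by (intro mult_left_mono) auto
    finally have "pois t k * pois t i * \<bar>f (n + k - i)\<bar> \<le>
        pois t k * pois t i * (K * exp (\<bar>real_of_int n\<bar> + \<bar>real_of_int k\<bar> + \<bar>real_of_int i\<bar>))"
      using p0 by (intro mult_left_mono) auto
    also have "\<dots> = K * exp \<bar>real_of_int n\<bar> * ((pois t k * exp \<bar>real_of_int k\<bar>) * (pois t i * exp \<bar>real_of_int i\<bar>))"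
      by (simp add: exp_add mult_ac)
    finally show "norm (?h x) \<le> (\<lambda>(k, i). K * exp \<bar>real_of_int n\<bar> * (?P k * ?P i)) x"
      unfolding Pexp using p0 by (simp add: x abs_mult)
  qed simp
  then have hs: "(?h has_sum infsum ?h (UNIV \<times> UNIV)) (UNIV \<times> UNIV)"
    using abs_summable_summable by (intro has_sum_infsum) blast
  have "((\<lambda>(j, i). pois t (i - (n - j)) * pois t i * f j) has_sum infsum ?h (UNIV \<times> UNIV)) (UNIV \<times> UNIV)"
    using hs
    by (rule has_sum_reindex_bij_witness[of _ "\<lambda>(j, i). (i - (n - j), i)" "\<lambda>(k, i). (n + k - i, i)", THEN iffD1, rotated -1])
       (auto simp: algebra_simps)
  then have "((\<lambda>j. heat_kernel t (n - j) * f j) has_sum infsum ?h (UNIV \<times> UNIV)) UNIV"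
    by (rule has_sum_SigmaD) (auto intro!: has_sum_cmult_left heat_kernel_has_sum t)
  moreover from this have "heat_semigroup t f n = infsum ?h (UNIV \<times> UNIV)"
    unfolding heat_semigroup_def by (rule infsumI)
  ultimately show "(\<lambda>j. heat_kernel t (n - j) * f j) summable_on UNIV"
    "(?h has_sum heat_semigroup t f n) (UNIV \<times> UNIV)"
    using hs by (auto intro: has_sum_imp_summable)
qed

section \<open>Growth bounds for the data\<close>

text \<open>
  The denominator in \<open>div_growth\<close>, comparable to \<open>jap n powr \<alpha>\<close>.
\<close>
definition growth :: "real \<Rightarrow> int \<Rightarrow> real" where
  "growth \<alpha> n = 1 + \<bar>real_of_int n\<bar> powr \<alpha>"

lemma growth_ge_1: "1 \<le> growth \<alpha> n" by (simp add: growth_def)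

lemma growth_pos: "0 < growth \<alpha> n" using growth_ge_1[of \<alpha> n] by linarith

lemma div_growth_eq: "div_growth \<alpha> f n = f n / growth \<alpha> n"
  by (simp add: div_growth_def growth_def)

lemma growth_le: "\<alpha> \<ge> 0 \<Longrightarrow> growth \<alpha> n \<le> 2 * jap n powr \<alpha>"
  using one_plus_powr_ge[of "\<bar>real_of_int n\<bar>" \<alpha>] by (simp add: growth_def jap_def)

lemma growth_ge: "\<alpha> \<ge> 0 \<Longrightarrow> jap n powr \<alpha> \<le> 2 powr \<alpha> * growth \<alpha> n"
  using one_plus_powr_le[of "\<bar>real_of_int n\<bar>" \<alpha>] by (simp add: growth_def jap_def)

lemma jap_peetre_powr:
  assumes "\<alpha> \<ge> 0" shows "jap j powr \<alpha> \<le> jap n powr \<alpha> * jap (n - j) powr \<alpha>"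
proof -
  have "jap j powr \<alpha> \<le> (jap n * jap (n - j)) powr \<alpha>"
    using jap_peetre jap_pos[of j] assms by (intro powr_mono2) auto
  then show ?thesis using jap_pos by (simp add: powr_mult less_imp_le)
qed

text \<open>
  The price for moving the weight from \<open>j\<close> to \<open>n\<close> depends on \<open>n - j\<close> only and can be charged to
  the kernel.
\<close>
lemma growth_peetre:
  assumes "\<alpha> \<ge> 0"
  shows "growth \<alpha> j \<le> 2 * 2 powr \<alpha> * jap (n - j) powr \<alpha> * growth \<alpha> n"
proof -
  have "growth \<alpha> j \<le> 2 * (jap n powr \<alpha> * jap (n - j) powr \<alpha>)"
    using growth_le[OF assms, of j] jap_peetre_powr[OF assms, of j n] by linarith
  also have "\<dots> \<le> 2 * ((2 powr \<alpha> * growth \<alpha> n) * jap (n - j) powr \<alpha>)"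
    using growth_ge[OF assms, of n] by (intro mult_left_mono mult_right_mono) auto
  finally show ?thesis by (simp add: mult_ac)
qed

lemma width_powr_le:
  assumes "t > 0" "\<beta> \<ge> 0"
  shows "width t powr \<beta> \<le> 2 powr (\<beta> / 2) * (1 + t powr (\<beta> / 2))"
proof -
  have "width t powr \<beta> = (1 + t) powr (\<beta> / 2)"
    using assms by (simp add: width_def powr_half_sqrt[symmetric] powr_powr)
  then show ?thesis using one_plus_powr_le[of t "\<beta> / 2"] assms by simp
qed

lemma powr_growth_imp_exp_growth:
  assumes "\<beta> \<ge> 0" "\<And>j. \<bar>f j\<bar> \<le> K * jap j powr \<beta>"
  obtains K' where "\<And>j. \<bar>f j\<bar> \<le> K' * exp \<bar>real_of_int j\<bar>"
proof -
  obtain C where C: "C > 0" "\<And>s k. s \<ge> 1 \<Longrightarrow> jap k powr \<beta> \<le> C * s powr \<beta> * exp (\<bar>real_of_int k\<bar> / s)"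
    using jap_powr_le_exp[OF assms(1)] by blast
  have K: "K \<ge> 0" using order_trans[OF abs_ge_zero assms(2)[of 0]] by (simp add: jap_def)
  have "\<bar>f j\<bar> \<le> (K * C) * exp \<bar>real_of_int j\<bar>" for j
  proof -
    have "\<bar>f j\<bar> \<le> K * jap j powr \<beta>" by (rule assms(2))
    also have "\<dots> \<le> K * (C * 1 powr \<beta> * exp (\<bar>real_of_int j\<bar> / 1))"
      by (intro mult_left_mono C K) auto
    finally show ?thesis by (simp add: mult_ac)
  qed
  then show thesis by (rule that)
qed

section \<open>Bounds in the weighted spaces\<close>

lemma abs_heat_semigroup_le:
  assumes t: "t > 0" and f: "\<And>j. \<bar>f j\<bar> \<le> K * exp \<bar>real_of_int j\<bar>"
  shows "(\<lambda>j. heat_kernel t (n - j) * \<bar>f j\<bar>) summable_on UNIV"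
    and "\<bar>heat_semigroup t f n\<bar> \<le> (\<Sum>\<^sub>\<infinity>j\<in>UNIV. heat_kernel t (n - j) * \<bar>f j\<bar>)"
proof -
  show s: "(\<lambda>j. heat_kernel t (n - j) * \<bar>f j\<bar>) summable_on UNIV"
    by (rule pois_pairs_has_sum_heat_semigroup(1)[OF t, of "\<lambda>j. \<bar>f j\<bar>" K]) (use f in simp)
  show "\<bar>heat_semigroup t f n\<bar> \<le> (\<Sum>\<^sub>\<infinity>j\<in>UNIV. heat_kernel t (n - j) * \<bar>f j\<bar>)"
    using norm_infsum_bound[of "\<lambda>j. heat_kernel t (n - j) * f j" UNIV] s
    by (simp add: heat_semigroup_def abs_mult heat_kernel_nonneg[OF t])
qed

lemma heat_semigroup_sup_bound:
  assumes \<alpha>: "\<alpha> \<ge> 0" and B: "B \<ge> 0" and f: "\<And>j. \<bar>f j\<bar> \<le> B * growth \<alpha> j"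
  shows "\<exists>C>0. \<forall>t>0. \<forall>n. \<bar>div_growth \<alpha> (heat_semigroup t f) n\<bar> \<le> C * (1 + t powr (\<alpha> / 2))"
proof -
  obtain D where D: "D > 0" "\<And>t F. t > 0 \<Longrightarrow> finite F \<Longrightarrow>
      (\<Sum>k\<in>F. heat_kernel t k * jap k powr \<alpha>) \<le> D * width t powr \<alpha>"
    using heat_kernel_moment_le[OF \<alpha>] by blast
  have "\<bar>f j\<bar> \<le> (2 * B) * jap j powr \<alpha>" for j
    using f[of j] mult_left_mono[OF growth_le[OF \<alpha>] B, of j] by (simp add: mult_ac)
  then obtain K where K: "\<And>j. \<bar>f j\<bar> \<le> K * exp \<bar>real_of_int j\<bar>"
    using powr_growth_imp_exp_growth[OF \<alpha>, of f "2 * B"] by blast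
  define c where "c = B * (2 * 2 powr \<alpha>)"
  have c: "c \<ge> 0" using B by (simp add: c_def)
  have main: "\<bar>div_growth \<alpha> (heat_semigroup t f) n\<bar> \<le> c * D * 2 powr (\<alpha> / 2) * (1 + t powr (\<alpha> / 2))"
    if t: "t > 0" for t n
  proof -
    note h = abs_heat_semigroup_le[OF t K, of n]
    have "(\<Sum>j\<in>F. heat_kernel t (n - j) * \<bar>f j\<bar>) \<le> c * growth \<alpha> n * (D * width t powr \<alpha>)"
      if F: "finite F" for F
    proof -
      have "heat_kernel t (n - j) * \<bar>f j\<bar> \<le> c * growth \<alpha> n * (heat_kernel t (n - j) * jap (n - j) powr \<alpha>)" for j
      proof -
        have "\<bar>f j\<bar> \<le> B * (2 * 2 powr \<alpha> * jap (n - j) powr \<alpha> * growth \<alpha> n)"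
          using f[of j] mult_left_mono[OF growth_peetre[OF \<alpha>] B, of j n] by linarith
        then have "heat_kernel t (n - j) * \<bar>f j\<bar> \<le>
            heat_kernel t (n - j) * (B * (2 * 2 powr \<alpha> * jap (n - j) powr \<alpha> * growth \<alpha> n))"
          by (rule mult_left_mono) (rule heat_kernel_nonneg[OF t])
        then show ?thesis by (simp add: c_def mult_ac)
      qed
      then have "(\<Sum>j\<in>F. heat_kernel t (n - j) * \<bar>f j\<bar>) \<le>
          (\<Sum>j\<in>F. c * growth \<alpha> n * (heat_kernel t (n - j) * jap (n - j) powr \<alpha>))" by (rule sum_mono)
      also have "\<dots> = c * growth \<alpha> n * (\<Sum>j\<in>F. heat_kernel t (n - j) * jap (n - j) powr \<alpha>)"
        by (simp only: sum_distrib_left)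
      also have "\<dots> \<le> c * growth \<alpha> n * (D * width t powr \<alpha>)"
        using c growth_pos[of \<alpha> n]
        by (intro mult_left_mono sum_convolution_weight_le(2) F D(2)[OF t]) auto
      finally show ?thesis .
    qed
    then have "\<bar>heat_semigroup t f n\<bar> \<le> c * growth \<alpha> n * (D * width t powr \<alpha>)"
      using h by (intro order_trans[OF h(2)] infsum_le_finite_sums) auto
    then have "\<bar>div_growth \<alpha> (heat_semigroup t f) n\<bar> \<le> c * (D * width t powr \<alpha>)"
      using growth_pos[of \<alpha> n] by (simp add: div_growth_eq divide_le_eq mult_ac)
    also have "\<dots> \<le> c * (D * (2 powr (\<alpha> / 2) * (1 + t powr (\<alpha> / 2))))"
      using c D(1) \<alpha> t by (intro mult_left_mono width_powr_le) auto
    finally show ?thesis by (simp add: mult_ac)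
  qed
  have "\<bar>div_growth \<alpha> (heat_semigroup t f) n\<bar> \<le> (c * D * 2 powr (\<alpha> / 2) + 1) * (1 + t powr (\<alpha> / 2))"
    if t: "t > 0" for t n
  proof (rule order_trans[OF main[OF t]])
    show "c * D * 2 powr (\<alpha> / 2) * (1 + t powr (\<alpha> / 2)) \<le> (c * D * 2 powr (\<alpha> / 2) + 1) * (1 + t powr (\<alpha> / 2))"
      by (intro mult_right_mono) auto
  qed
  moreover have "c * D * 2 powr (\<alpha> / 2) + 1 > 0" using c D(1) by (simp add: add_nonneg_pos)
  ultimately show ?thesis by blast
qed

text \<open>
  Each term of a convergent nonnegative series is at most its sum. This loses a factor \<open>jap j\<close> from
  the measure, but it suffices for convergence of the semigroup.
\<close>
lemma lq_mu_powr_growth: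
  assumes r: "r \<ge> 1" and \<alpha>: "\<alpha> \<ge> 0"
    and sm: "(\<lambda>n. \<bar>div_growth \<alpha> f n\<bar> powr r / jap n) summable_on UNIV"
  obtains K where "\<And>j. \<bar>f j\<bar> powr r \<le> K * jap j powr (\<alpha> * r + 1)"
proof -
  define Q where "Q = (\<Sum>\<^sub>\<infinity>n\<in>UNIV. \<bar>div_growth \<alpha> f n\<bar> powr r / jap n)"
  have "\<bar>f j\<bar> powr r \<le> (Q * 2 powr r) * jap j powr (\<alpha> * r + 1)" for j
  proof -
    have "\<bar>div_growth \<alpha> f j\<bar> powr r / jap j \<le> Q"
      unfolding Q_def using finite_sum_le_infsum[OF sm, of "{j}"] jap_pos by (simp add: less_imp_le)
    then have a: "\<bar>div_growth \<alpha> f j\<bar> powr r \<le> Q * jap j" using jap_pos[of j] by (simp add: divide_le_eq)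
    have "\<bar>f j\<bar> powr r = \<bar>div_growth \<alpha> f j\<bar> powr r * growth \<alpha> j powr r"
      using growth_pos[of \<alpha> j] by (simp add: div_growth_eq powr_mult[symmetric])
    also have "\<dots> \<le> (Q * jap j) * (2 * jap j powr \<alpha>) powr r"
      using a growth_le[OF \<alpha>, of j] growth_pos[of \<alpha> j] r jap_pos[of j] order_trans[OF powr_ge_zero a]
      by (intro mult_mono powr_mono2) auto
    also have "\<dots> = (Q * 2 powr r) * jap j powr (\<alpha> * r + 1)"
      using jap_pos[of j] by (simp add: powr_mult powr_powr powr_add)
    finally show ?thesis .
  qed
  then show thesis by (rule that)
qed

lemma powr_bound_imp_bound:
  assumes r: "r \<ge> 1" and \<beta>: "\<beta> \<ge> 0" and K: "\<And>j. \<bar>f j\<bar> powr r \<le> K * jap j powr \<beta>"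
  shows "\<bar>f j\<bar> \<le> (1 + K) * jap j powr \<beta>"
proof -
  have "\<bar>f j\<bar> \<le> 1 + K * jap j powr \<beta>"
    using le_one_plus_powr[of "\<bar>f j\<bar>" r] r K[of j] by simp
  moreover have "1 \<le> jap j powr \<beta>" using jap_ge_1 \<beta> by (rule ge_one_powr_ge_zero)
  ultimately show ?thesis by (simp add: algebra_simps)
qed

text \<open>
  Jensen's inequality moves the power \<open>r\<close> inside the convolution. After exchanging the sums, the
  factor in front of each term of the norm of the data is a moment of the kernel of order
  \<open>\<alpha> * r + 1\<close>, the degree of the full weight \<open>W\<close>.
\<close>
lemma heat_semigroup_lq_bound:
  assumes r: "r \<ge> 1" and \<alpha>: "\<alpha> \<ge> 0"
    and sm: "(\<lambda>n. \<bar>div_growth \<alpha> f n\<bar> powr r / jap n) summable_on UNIV"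
  shows "\<exists>C>0. \<forall>t>0.
      (\<lambda>n. \<bar>div_growth \<alpha> (heat_semigroup t f) n\<bar> powr r / jap n) summable_on UNIV \<and>
      (\<Sum>\<^sub>\<infinity>n\<in>UNIV. \<bar>div_growth \<alpha> (heat_semigroup t f) n\<bar> powr r / jap n) powr (1 / r)
        \<le> C * (1 + t powr ((\<alpha> + 1 / r) / 2))"
proof -
  define \<gamma> where "\<gamma> = \<alpha> * r + 1"
  define a where "a n = \<bar>div_growth \<alpha> f n\<bar> powr r / jap n" for n
  define Q where "Q = infsum a UNIV"
  define W where "W n = growth \<alpha> n powr r * jap n" for n
  have \<gamma>: "\<gamma> \<ge> 0" using \<alpha> r by (simp add: \<gamma>_def)
  have a0: "a n \<ge> 0" for n using jap_pos[of n] by (simp add: a_def)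
  have Q0: "Q \<ge> 0" unfolding Q_def by (intro infsum_nonneg a0)
  have asm: "a summable_on UNIV" using sm by (simp add: a_def[abs_def])
  have W0: "W n > 0" for n using jap_pos[of n] growth_pos[of \<alpha> n] by (simp add: W_def)
  have quot: "\<bar>div_growth \<alpha> h n\<bar> powr r / jap n = \<bar>h n\<bar> powr r / W n" for h n
    using growth_pos[of \<alpha> n] by (simp add: div_growth_eq W_def powr_divide)
  have fW: "\<bar>f j\<bar> powr r = W j * a j" for j
    using W0[of j] by (simp add: a_def quot)
  define c2 where "c2 = (2 * 2 powr \<alpha>) powr r"
  have WW: "W j \<le> c2 * jap (n - j) powr \<gamma> * W n" for n j
  proof -
    have "growth \<alpha> j powr r \<le> (2 * 2 powr \<alpha> * jap (n - j) powr \<alpha> * growth \<alpha> n) powr r"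
      using growth_peetre[OF \<alpha>, of j n] growth_pos[of \<alpha> j] r by (intro powr_mono2) auto
    also have "\<dots> = c2 * jap (n - j) powr (\<alpha> * r) * growth \<alpha> n powr r"
      using growth_pos[of \<alpha> n] by (simp add: powr_mult powr_powr c2_def)
    finally have "W j \<le> (c2 * jap (n - j) powr (\<alpha> * r) * growth \<alpha> n powr r) * (jap n * jap (n - j))"
      unfolding W_def using jap_peetre[of j n] jap_pos by (intro mult_mono) (auto simp: c2_def less_imp_le)
    also have "\<dots> = c2 * jap (n - j) powr \<gamma> * W n"
      using jap_pos[of "n - j"] by (simp add: W_def \<gamma>_def powr_add mult_ac)
    finally show ?thesis .
  qed
  obtain K where K: "\<And>j. \<bar>f j\<bar> powr r \<le> K * jap j powr \<gamma>"
    using lq_mu_powr_growth[OF r \<alpha> sm] unfolding \<gamma>_def by blast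
  obtain K1 where K1: "\<And>j. \<bar>f j\<bar> \<le> K1 * exp \<bar>real_of_int j\<bar>"
    using powr_growth_imp_exp_growth[OF \<gamma> powr_bound_imp_bound[OF r \<gamma> K]] by blast
  obtain K2 where K2: "\<And>j. \<bar>\<bar>f j\<bar> powr r\<bar> \<le> K2 * exp \<bar>real_of_int j\<bar>"
    using powr_growth_imp_exp_growth[OF \<gamma>, of "\<lambda>j. \<bar>f j\<bar> powr r" K] K by auto
  obtain D0 where D0: "D0 > 0" "\<And>t F. t > 0 \<Longrightarrow> finite F \<Longrightarrow>
      (\<Sum>k\<in>F. heat_kernel t k * jap k powr 0) \<le> D0 * width t powr 0"
    using heat_kernel_moment_le[of 0] by blast
  obtain D where D: "D > 0" "\<And>t F. t > 0 \<Longrightarrow> finite F \<Longrightarrow>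
      (\<Sum>k\<in>F. heat_kernel t k * jap k powr \<gamma>) \<le> D * width t powr \<gamma>"
    using heat_kernel_moment_le[OF \<gamma>] by blast
  define c1 where "c1 = (D0 + 1) powr r"
  \<comment> \<open>\<open>Q + 1\<close> instead of \<open>Q\<close> keeps the constant positive when the data vanish.\<close>
  define T where "T = c1 * c2 * D * (Q + 1)"
  have pos: "c1 > 0" "c2 > 0" "T > 0" using D0(1) D(1) Q0 by (auto simp: c1_def c2_def T_def)
  have main: "(\<lambda>n. \<bar>div_growth \<alpha> (heat_semigroup t f) n\<bar> powr r / jap n) summable_on UNIV"
    "(\<Sum>\<^sub>\<infinity>n\<in>UNIV. \<bar>div_growth \<alpha> (heat_semigroup t f) n\<bar> powr r / jap n) \<le> T * width t powr \<gamma>"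
    if t: "t > 0" for t
  proof -
    let ?G = "heat_kernel t"
    have G0: "0 \<le> ?G k" for k by (rule heat_kernel_nonneg[OF t])
    have Gr: "(\<lambda>j. ?G (n - j) * \<bar>f j\<bar> powr r) summable_on UNIV" for n
      by (rule pois_pairs_has_sum_heat_semigroup(1)[OF t K2])
    have point: "\<bar>heat_semigroup t f n\<bar> powr r \<le> c1 * (\<Sum>\<^sub>\<infinity>j\<in>UNIV. ?G (n - j) * \<bar>f j\<bar> powr r)" for n
    proof -
      note h = abs_heat_semigroup_le[OF t K1, of n]
      have Gs: "(\<lambda>j. ?G (n - j)) summable_on UNIV" "(\<Sum>\<^sub>\<infinity>j\<in>UNIV. ?G (n - j)) \<le> D0"
      proof -
        have "(\<Sum>j\<in>F. ?G (n - j)) \<le> D0" if "finite F" for F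
          using sum_convolution_weight_le(2)[OF that D0(2)[OF t], of n] jap_pos width_ge_1[OF t]
          by (auto simp: less_imp_neq[THEN not_sym])
        then show "(\<lambda>j. ?G (n - j)) summable_on UNIV" "(\<Sum>\<^sub>\<infinity>j\<in>UNIV. ?G (n - j)) \<le> D0"
          using nonneg_sums_bounded[of "\<lambda>j. ?G (n - j)" D0] G0 by auto
      qed
      have "\<bar>heat_semigroup t f n\<bar> powr r \<le> (\<Sum>\<^sub>\<infinity>j\<in>UNIV. ?G (n - j) * \<bar>f j\<bar>) powr r"
        using h(2) r by (intro powr_mono2) auto
      also have "\<dots> \<le> c1 * (\<Sum>\<^sub>\<infinity>j\<in>UNIV. ?G (n - j) * \<bar>f j\<bar> powr r)"
        unfolding c1_def by (rule powr_infsum_le[OF r G0 Gs _ h(1) Gr]) simp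
      finally show ?thesis .
    qed
    have fin: "(\<Sum>n\<in>F. \<bar>div_growth \<alpha> (heat_semigroup t f) n\<bar> powr r / jap n) \<le> T * width t powr \<gamma>"
      if F: "finite F" for F
    proof -
      have "(\<Sum>n\<in>F. \<bar>div_growth \<alpha> (heat_semigroup t f) n\<bar> powr r / jap n) \<le>
          (\<Sum>n\<in>F. c1 * (\<Sum>\<^sub>\<infinity>j\<in>UNIV. ?G (n - j) * \<bar>f j\<bar> powr r / W n))"
      proof (rule sum_mono)
        fix n
        have "\<bar>heat_semigroup t f n\<bar> powr r / W n \<le> c1 * (\<Sum>\<^sub>\<infinity>j\<in>UNIV. ?G (n - j) * \<bar>f j\<bar> powr r) / W n"
          using point[of n] W0[of n] by (intro divide_right_mono) auto
        also have "\<dots> = c1 * ((\<Sum>\<^sub>\<infinity>j\<in>UNIV. ?G (n - j) * \<bar>f j\<bar> powr r) * (1 / W n))" by simp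
        also have "(\<Sum>\<^sub>\<infinity>j\<in>UNIV. ?G (n - j) * \<bar>f j\<bar> powr r) * (1 / W n) =
            (\<Sum>\<^sub>\<infinity>j\<in>UNIV. ?G (n - j) * \<bar>f j\<bar> powr r * (1 / W n))"
          by (rule infsum_cmult_left[symmetric]) (rule Gr)
        finally show "\<bar>div_growth \<alpha> (heat_semigroup t f) n\<bar> powr r / jap n \<le>
            c1 * (\<Sum>\<^sub>\<infinity>j\<in>UNIV. ?G (n - j) * \<bar>f j\<bar> powr r / W n)"
          by (simp add: quot)
      qed
      also have "\<dots> = c1 * (\<Sum>n\<in>F. \<Sum>\<^sub>\<infinity>j\<in>UNIV. ?G (n - j) * \<bar>f j\<bar> powr r / W n)"
        by (simp only: sum_distrib_left)
      also have "\<dots> \<le> c1 * (\<Sum>\<^sub>\<infinity>j\<in>UNIV. c2 * (D * width t powr \<gamma>) * a j)"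
      proof (rule mult_left_mono[OF sum_infsum_le[OF F]])
        show "(\<lambda>j. ?G (n - j) * \<bar>f j\<bar> powr r / W n) summable_on UNIV" for n
          using summable_on_cmult_left[OF Gr, of n "1 / W n"] by simp
        show "(\<lambda>j. c2 * (D * width t powr \<gamma>) * a j) summable_on UNIV"
          by (intro summable_on_cmult_right asm)
        fix j
        have "?G (n - j) * \<bar>f j\<bar> powr r / W n \<le> c2 * a j * (?G (n - j) * jap (n - j) powr \<gamma>)" for n
        proof -
          have "?G (n - j) * (W j * a j) \<le> ?G (n - j) * ((c2 * jap (n - j) powr \<gamma> * W n) * a j)"
            by (intro mult_left_mono mult_right_mono WW G0 a0)
          then show ?thesis using W0[of n] by (simp add: fW divide_le_eq mult_ac)
        qed
        then have "(\<Sum>n\<in>F. ?G (n - j) * \<bar>f j\<bar> powr r / W n) \<le>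
            (\<Sum>n\<in>F. c2 * a j * (?G (n - j) * jap (n - j) powr \<gamma>))" by (rule sum_mono)
        also have "\<dots> = c2 * a j * (\<Sum>n\<in>F. ?G (n - j) * jap (n - j) powr \<gamma>)"
          by (simp only: sum_distrib_left)
        also have "\<dots> \<le> c2 * a j * (D * width t powr \<gamma>)"
          using pos a0[of j] by (intro mult_left_mono sum_convolution_weight_le(1) F D(2)[OF t]) auto
        finally show "(\<Sum>n\<in>F. ?G (n - j) * \<bar>f j\<bar> powr r / W n) \<le> c2 * (D * width t powr \<gamma>) * a j"
          by (simp add: mult_ac)
      qed (use pos in simp)
      also have "(\<Sum>\<^sub>\<infinity>j\<in>UNIV. c2 * (D * width t powr \<gamma>) * a j) = c2 * (D * width t powr \<gamma>) * Q"
        unfolding Q_def by (rule infsum_cmult_right) (rule asm)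
      also have "c1 * \<dots> \<le> T * width t powr \<gamma>"
        unfolding T_def using pos D(1) by (simp add: mult_ac mult_left_mono mult_right_mono)
      finally show ?thesis .
    qed
    show "(\<lambda>n. \<bar>div_growth \<alpha> (heat_semigroup t f) n\<bar> powr r / jap n) summable_on UNIV"
      "(\<Sum>\<^sub>\<infinity>n\<in>UNIV. \<bar>div_growth \<alpha> (heat_semigroup t f) n\<bar> powr r / jap n) \<le> T * width t powr \<gamma>"
      using nonneg_sums_bounded[OF _ fin] jap_pos by (auto simp: less_imp_le)
  qed
  let ?e = "\<alpha> + 1 / r"
  have "(\<Sum>\<^sub>\<infinity>n\<in>UNIV. \<bar>div_growth \<alpha> (heat_semigroup t f) n\<bar> powr r / jap n) powr (1 / r)
      \<le> (T powr (1 / r) * 2 powr (?e / 2)) * (1 + t powr (?e / 2))" if t: "t > 0" for t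
  proof -
    have "(\<Sum>\<^sub>\<infinity>n\<in>UNIV. \<bar>div_growth \<alpha> (heat_semigroup t f) n\<bar> powr r / jap n) powr (1 / r)
        \<le> (T * width t powr \<gamma>) powr (1 / r)"
      using main[OF t] r jap_pos by (intro powr_mono2 infsum_nonneg) (auto simp: less_imp_le)
    also have "\<dots> = T powr (1 / r) * width t powr ?e"
      using pos width_ge_1[OF t] r by (simp add: powr_mult powr_powr \<gamma>_def add_divide_distrib)
    also have "\<dots> \<le> T powr (1 / r) * (2 powr (?e / 2) * (1 + t powr (?e / 2)))"
      using \<alpha> r t by (intro mult_left_mono width_powr_le) auto
    finally show ?thesis by (simp add: mult_ac)
  qed
  moreover have "T powr (1 / r) * 2 powr (?e / 2) > 0" using pos by simp
  ultimately show ?thesis using main(1) by blast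
qed

section \<open>The heat equation\<close>

text \<open>
  The coefficient of \<open>t\<^sup>N\<close> in \<open>exp (t S) f (n)\<close> for the sum \<open>S\<close> of the two unit shifts; the
  Laplacian is \<open>S - 2\<close>.
\<close>
definition heat_coeff :: "(int \<Rightarrow> real) \<Rightarrow> nat \<Rightarrow> int \<Rightarrow> real" where
  "heat_coeff f N n = (\<Sum>i\<le>N. f (n + int (N - i) - int i) / (fact i * fact (N - i)))"

text \<open>
  This is Pascal's rule: write \<open>N + 1 = (N + 1 - i) + i\<close> and cancel each summand against one of the two
  factorials.
\<close>
lemma heat_coeff_Suc:
  "real (Suc N) * heat_coeff f (Suc N) n = heat_coeff f N (n + 1) + heat_coeff f N (n - 1)"
proof -
  let ?X = "\<lambda>i. f (n + int (Suc N - i) - int i) / (fact i * fact (Suc N - i))"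
  have "real (Suc N) * heat_coeff f (Suc N) n = (\<Sum>i\<le>Suc N. (real (Suc N - i) + real i) * ?X i)"
    unfolding heat_coeff_def sum_distrib_left by (intro sum.cong) auto
  also have "\<dots> = (\<Sum>i\<le>Suc N. real (Suc N - i) * ?X i) + (\<Sum>i\<le>Suc N. real i * ?X i)"
    by (simp only: distrib_right sum.distrib)
  also have "(\<Sum>i\<le>Suc N. real (Suc N - i) * ?X i) = (\<Sum>i\<le>N. real (Suc N - i) * ?X i)" by simp
  also have "\<dots> = heat_coeff f N (n + 1)"
    unfolding heat_coeff_def
  proof (rule sum.cong)
    fix i assume "i \<in> {..N}"
    then have e: "Suc N - i = Suc (N - i)" by auto
    show "real (Suc N - i) * ?X i = f (n + 1 + int (N - i) - int i) / (fact i * fact (N - i))"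
      unfolding e by (simp add: add_ac divide_simps)
  qed simp
  also have "(\<Sum>i\<le>Suc N. real i * ?X i) = (\<Sum>i\<le>N. real (Suc i) * ?X (Suc i))"
    unfolding sum.atMost_Suc_shift by simp
  also have "\<dots> = heat_coeff f N (n - 1)"
    unfolding heat_coeff_def
  proof (rule sum.cong)
    fix i
    have e: "n + int (N - i) - int (Suc i) = n - 1 + int (N - i) - int i" by simp
    show "real (Suc i) * ?X (Suc i) = f (n - 1 + int (N - i) - int i) / (fact i * fact (N - i))"
      unfolding diff_Suc_Suc e by (simp add: divide_simps)
  qed simp
  finally show ?thesis .
qed

text \<open>
  Group the pairs of Poisson indices by their sum \<open>N\<close>.
\<close>
lemma heat_semigroup_power_series:
  assumes t: "t > 0" and f: "\<And>j. \<bar>f j\<bar> \<le> K * exp \<bar>real_of_int j\<bar>"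
  shows "(\<lambda>N. heat_coeff f N n * t ^ N) sums (exp (2 * t) * heat_semigroup t f n)"
proof -
  let ?h = "\<lambda>(k, i). pois t k * pois t i * f (n + k - i)"
  let ?\<phi> = "\<lambda>(N, i). (int (N - i), int i)"
  let ?S = "SIGMA N:UNIV. {..N::nat}"
  note hs = pois_pairs_has_sum_heat_semigroup(2)[OF t f, of n]
  have img: "?h x = 0" if "x \<notin> ?\<phi> ` ?S" for x
  proof -
    obtain k i where x: "x = (k, i)" by fastforce
    have "k < 0 \<or> i < 0"
    proof (rule ccontr)
      assume "\<not> (k < 0 \<or> i < 0)"
      then obtain a b where "k = int a" "i = int b" by (meson not_less nonneg_int_cases)
      then have "x = ?\<phi> (a + b, b)" by (simp add: x)
      moreover have "(a + b, b) \<in> ?S" by simp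
      ultimately show False using that by (rule notE[OF _ image_eqI, rotated])
    qed
    then show ?thesis by (auto simp: x pois_def)
  qed
  have "inj_on ?\<phi> ?S" by (auto simp: inj_on_def)
  moreover have "(?h has_sum heat_semigroup t f n) (?\<phi> ` ?S)"
    by (rule has_sum_cong_neutral[THEN iffD1, OF _ _ _ hs]) (use img in auto)
  ultimately have "((?h \<circ> ?\<phi>) has_sum heat_semigroup t f n) ?S"
    by (subst (asm) has_sum_reindex) auto
  then have "((\<lambda>N. \<Sum>i\<in>{..N}. (?h \<circ> ?\<phi>) (N, i)) has_sum heat_semigroup t f n) UNIV"
    by (rule has_sum_SigmaD) (rule has_sum_finite[OF finite_atMost])
  moreover have "(\<Sum>i\<in>{..N}. (?h \<circ> ?\<phi>) (N, i)) = exp (- 2 * t) * (heat_coeff f N n * t ^ N)" for N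
    unfolding heat_coeff_def sum_distrib_left sum_distrib_right
  proof (rule sum.cong)
    fix i assume "i \<in> {..N}"
    then have "t ^ (N - i) * t ^ i = t ^ N" by (simp add: power_add[symmetric])
    moreover have "exp (- t) * exp (- t) = exp (- 2 * t)" by (simp add: exp_add[symmetric])
    ultimately show "(?h \<circ> ?\<phi>) (N, i) = exp (- 2 * t) *
        (f (n + int (N - i) - int i) / (fact i * fact (N - i)) * t ^ N)"
      by (simp add: pois_of_nat) (metis (no_types, lifting) mult.assoc mult.commute)
  qed simp
  ultimately have "(\<lambda>N. exp (- 2 * t) * (heat_coeff f N n * t ^ N)) sums heat_semigroup t f n"
    by (intro has_sum_imp_sums) simp
  from sums_mult[OF this, of "exp (2 * t)"] show ?thesis
    by (simp add: mult.assoc[symmetric] exp_add[symmetric])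
qed

text \<open>
  Termwise differentiation of the power series. The Laplacian at \<open>n\<close> is the second forward
  difference based at \<open>n - 1\<close>.
\<close>
lemma heat_equation:
  assumes t: "t > 0" and f: "\<And>j. \<bar>f j\<bar> \<le> K * exp \<bar>real_of_int j\<bar>"
  shows "((\<lambda>s. heat_semigroup s f n) has_field_derivative
           (delta_right ^^ 2) (heat_semigroup t f) (n - 1)) (at t)"
proof -
  note ps = heat_semigroup_power_series[OF _ f]
  let ?F = "\<lambda>s. \<Sum>N. heat_coeff f N n * s ^ N"
  have "((\<lambda>s. ?F s) has_field_derivative (\<Sum>N. diffs (\<lambda>N. heat_coeff f N n) N * t ^ N)) (at t)"
    by (rule termdiffs_strong[where K = "t + 1"]) (use t ps[of "t + 1" n] in \<open>auto simp: sums_iff\<close>)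
  moreover have "(\<Sum>N. diffs (\<lambda>N. heat_coeff f N n) N * t ^ N) =
      exp (2 * t) * heat_semigroup t f (n + 1) + exp (2 * t) * heat_semigroup t f (n - 1)"
    unfolding diffs_def heat_coeff_Suc
    using sums_add[OF ps[OF t, of "n + 1"] ps[OF t, of "n - 1"]]
    by (intro sums_unique[symmetric]) (simp add: distrib_right)
  ultimately have F': "(?F has_field_derivative
      exp (2 * t) * heat_semigroup t f (n + 1) + exp (2 * t) * heat_semigroup t f (n - 1)) (at t)" by simp
  have ee: "exp (- (2 * s)) * (exp (2 * s) * x) = x" for s x :: real
    by (simp add: mult.assoc[symmetric] exp_add[symmetric])
  have Ft: "?F s = exp (2 * s) * heat_semigroup s f n" if "s > 0" for s
    using ps[OF that, of n] by (rule sums_unique[symmetric])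
  have "((\<lambda>s. exp (- (2 * s)) * ?F s) has_field_derivative
      (- 2 * exp (- (2 * t))) * ?F t + (exp (2 * t) * heat_semigroup t f (n + 1) +
        exp (2 * t) * heat_semigroup t f (n - 1)) * exp (- (2 * t))) (at t)"
    by (rule DERIV_mult[OF _ F']) (auto intro!: derivative_eq_intros)
  also have "(- 2 * exp (- (2 * t))) * ?F t + (exp (2 * t) * heat_semigroup t f (n + 1) +
        exp (2 * t) * heat_semigroup t f (n - 1)) * exp (- (2 * t)) =
      - 2 * (exp (- (2 * t)) * (exp (2 * t) * heat_semigroup t f n)) +
      (exp (- (2 * t)) * (exp (2 * t) * heat_semigroup t f (n + 1)) +
       exp (- (2 * t)) * (exp (2 * t) * heat_semigroup t f (n - 1)))"
    unfolding Ft[OF t] by (simp add: algebra_simps)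
  also have "\<dots> = (delta_right ^^ 2) (heat_semigroup t f) (n - 1)"
    unfolding ee by (simp add: numeral_2_eq_2 delta_right_def)
  finally show ?thesis
  proof (rule has_field_derivative_transform_within_open[where S = "{0<..}"])
    show "exp (- (2 * s)) * ?F s = heat_semigroup s f n" if "s \<in> {0<..}" for s
      using that by (simp only: Ft greaterThan_iff ee)
  qed (use t in auto)
qed

lemma heat_equation_delta:
  assumes t: "t > 0" and f: "\<And>j. \<bar>f j\<bar> \<le> K * exp \<bar>real_of_int j\<bar>"
  shows "((\<lambda>s. (delta_right ^^ m) (heat_semigroup s f) n) has_field_derivative
           (delta_right ^^ (m + 2)) (heat_semigroup t f) (n - 1)) (at t)"
proof (induction m arbitrary: n)
  case 0
  then show ?case using heat_equation[OF t f] by (simp add: numeral_2_eq_2)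
next
  case (Suc m)
  show ?case
    using DERIV_diff[OF Suc.IH[of n] Suc.IH[of "n + 1"]]
    unfolding add_Suc funpow_delta_Suc by (simp del: funpow.simps)
qed

lemma higher_deriv_heat:
  assumes f: "\<And>j. \<bar>f j\<bar> \<le> K * exp \<bar>real_of_int j\<bar>" and "t > 0"
  shows "(deriv ^^ k) (\<lambda>s. (delta_right ^^ m) (heat_semigroup s f) n) t =
      (delta_right ^^ (m + 2 * k)) (heat_semigroup t f) (n - int k)" (is ?eq)
    and "((deriv ^^ k) (\<lambda>s. (delta_right ^^ m) (heat_semigroup s f) n) has_field_derivative
      (delta_right ^^ (m + 2 * Suc k)) (heat_semigroup t f) (n - int (Suc k))) (at t)"
proof -
  let ?D = "\<lambda>k. (deriv ^^ k) (\<lambda>s. (delta_right ^^ m) (heat_semigroup s f) n)"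
  \<comment> \<open>The formula for the \<open>k\<close>-th derivative holds on an open half line only, which suffices since derivatives are local.\<close>
  have step: "(?D k has_field_derivative
      (delta_right ^^ (m + 2 * Suc k)) (heat_semigroup t f) (n - int (Suc k))) (at t)"
    if t: "t > 0" and eq: "\<And>s. s > 0 \<Longrightarrow> ?D k s = (delta_right ^^ (m + 2 * k)) (heat_semigroup s f) (n - int k)"
    for t k
  proof (rule has_field_derivative_transform_within_open[where S = "{0<..}"])
    show "((\<lambda>s. (delta_right ^^ (m + 2 * k)) (heat_semigroup s f) (n - int k)) has_field_derivative
        (delta_right ^^ (m + 2 * Suc k)) (heat_semigroup t f) (n - int (Suc k))) (at t)"
    proof -
      have e: "m + 2 * k + 2 = m + 2 * Suc k" "n - int k - 1 = n - int (Suc k)" by auto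
      show ?thesis using heat_equation_delta[OF t f, of "m + 2 * k" "n - int k"] unfolding e .
    qed
  qed (use t eq in auto)
  have eq: "?D k t = (delta_right ^^ (m + 2 * k)) (heat_semigroup t f) (n - int k)" if "t > 0" for t
    using that
  proof (induction k arbitrary: t)
    case 0
    then show ?case by simp
  next
    case (Suc k)
    have "?D (Suc k) t = deriv (?D k) t" by simp
    also have "\<dots> = (delta_right ^^ (m + 2 * Suc k)) (heat_semigroup t f) (n - int (Suc k))"
      by (rule DERIV_imp_deriv, rule step[OF Suc.prems Suc.IH])
    finally show ?case .
  qed
  show ?eq by (rule eq[OF \<open>t > 0\<close>])
  show "(?D k has_field_derivative
      (delta_right ^^ (m + 2 * Suc k)) (heat_semigroup t f) (n - int (Suc k))) (at t)"
    by (rule step[OF \<open>t > 0\<close> eq])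
qed

section \<open>Decay of differences and the final estimate\<close>

text \<open>
  Bounded data times \<open>jap j powr \<alpha>\<close> meet the weighted sum of the kernel difference, of size
  \<open>s powr (\<alpha> - M)\<close>. Summable data times \<open>jap j powr (\<alpha> + 1)\<close> meet its weighted supremum, of size
  \<open>s powr ((\<alpha> + 1) - (M + 1))\<close>. The two exponents coincide, which is why the decay does not depend
  on the exponent of the space.
\<close>
lemma delta_heat_semigroup_le:
  assumes \<alpha>: "\<alpha> \<ge> 0" and B: "B \<ge> 0" and h: "\<And>j. 0 \<le> h j" "h summable_on UNIV"
    and f: "\<And>j. \<bar>f j\<bar> \<le> jap j powr \<alpha> * (B + jap j * h j)"
    and K: "\<And>j. \<bar>f j\<bar> \<le> K * exp \<bar>real_of_int j\<bar>"
  shows "\<exists>C. \<forall>t\<ge>1. \<bar>(delta_right ^^ M) (heat_semigroup t f) n\<bar> \<le> C * width t powr (\<alpha> - real M)"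
proof -
  have \<alpha>1: "\<alpha> + 1 \<ge> 0" using \<alpha> by simp
  obtain A where A: "A > 0" "\<And>s k. s \<ge> 1 \<Longrightarrow> jap k powr \<alpha> \<le> A * s powr \<alpha> * exp (\<bar>real_of_int k\<bar> / s)"
    using jap_powr_le_exp[OF \<alpha>] by blast
  obtain A' where A': "A' > 0" "\<And>s k. s \<ge> 1 \<Longrightarrow> jap k powr (\<alpha> + 1) \<le> A' * s powr (\<alpha> + 1) * exp (\<bar>real_of_int k\<bar> / s)"
    using jap_powr_le_exp[OF \<alpha>1] by blast
  obtain D where D: "D \<ge> 0" "\<And>t F. t \<ge> 1 \<Longrightarrow> finite F \<Longrightarrow>
     (\<Sum>n\<in>F. \<bar>(delta_right ^^ M) (heat_kernel t) n\<bar> * exp (\<bar>real_of_int n\<bar> / width t)) \<le> D / width t ^ M"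
    using delta_heat_kernel_weighted_sum_le[of M] by blast
  obtain D' where D': "D' \<ge> 0" "\<And>t n. t \<ge> 1 \<Longrightarrow>
     \<bar>(delta_right ^^ M) (heat_kernel t) n\<bar> * exp (\<bar>real_of_int n\<bar> / width t) \<le> D' / width t ^ Suc M"
    using delta_heat_kernel_weighted_sup_le[of M] by blast
  define H where "H = infsum h UNIV"
  define C where "C = B * jap n powr \<alpha> * A * D + jap n powr (\<alpha> + 1) * A' * D' * H"
  have "\<bar>(delta_right ^^ M) (heat_semigroup t f) n\<bar> \<le> C * width t powr (\<alpha> - real M)" if t1: "t \<ge> 1" for t
  proof -
    have t: "t > 0" using t1 by simp
    define s where "s = width t"
    have s: "s \<ge> 1" using width_ge_1[OF t] by (simp add: s_def)
    let ?g = "\<lambda>k. \<bar>(delta_right ^^ M) (heat_kernel t) k\<bar>"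
    let ?e = "\<lambda>k. exp (\<bar>real_of_int k\<bar> / s)"
    have hs: "(\<lambda>j. heat_kernel t (n - j) * f j) summable_on UNIV" for n
      by (rule pois_pairs_has_sum_heat_semigroup(1)[OF t K])
    have "heat_semigroup t f = (\<lambda>n. \<Sum>\<^sub>\<infinity>j\<in>UNIV. heat_kernel t (n - j) * f j)"
      by (rule ext) (rule heat_semigroup_def)
    then have rep: "(delta_right ^^ M) (heat_semigroup t f) n =
        (\<Sum>\<^sub>\<infinity>j\<in>UNIV. (delta_right ^^ M) (heat_kernel t) (n - j) * f j)"
      using funpow_delta_right_infsum(2)[of "\<lambda>j n. heat_kernel t (n - j) * f j", OF hs, of M n]
      by (simp only: funpow_delta_right_shift)
    have fin: "(\<Sum>j\<in>F. ?g (n - j) * \<bar>f j\<bar>) \<le> C * s powr (\<alpha> - real M)" if F: "finite F" for F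
    proof -
      have "?g (n - j) * \<bar>f j\<bar> \<le> B * jap n powr \<alpha> * (A * s powr \<alpha>) * (?g (n - j) * ?e (n - j)) +
          jap n powr (\<alpha> + 1) * (A' * s powr (\<alpha> + 1)) * (D' / s ^ Suc M) * h j" for j
      proof -
        have "?g (n - j) * jap j powr \<alpha> \<le> ?g (n - j) * (jap n powr \<alpha> * (A * s powr \<alpha> * ?e (n - j)))"
          using order_trans[OF jap_peetre_powr[OF \<alpha>, of j n] mult_left_mono[OF A(2)[OF s, of "n - j"], of "jap n powr \<alpha>"]]
          by (intro mult_left_mono) auto
        from mult_left_mono[OF this B] have 1: "B * (?g (n - j) * jap j powr \<alpha>) \<le>
            B * jap n powr \<alpha> * (A * s powr \<alpha>) * (?g (n - j) * ?e (n - j))" by (simp add: mult_ac)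
        have "?g (n - j) * jap j powr (\<alpha> + 1) \<le> ?g (n - j) * (jap n powr (\<alpha> + 1) * (A' * s powr (\<alpha> + 1) * ?e (n - j)))"
          using order_trans[OF jap_peetre_powr[OF \<alpha>1, of j n] mult_left_mono[OF A'(2)[OF s, of "n - j"], of "jap n powr (\<alpha> + 1)"]]
          by (intro mult_left_mono) auto
        also have "\<dots> = jap n powr (\<alpha> + 1) * (A' * s powr (\<alpha> + 1)) * (?g (n - j) * ?e (n - j))" by (simp only: mult_ac)
        also have "\<dots> \<le> jap n powr (\<alpha> + 1) * (A' * s powr (\<alpha> + 1)) * (D' / s ^ Suc M)"
          using D'(2)[OF t1, of "n - j"] A'(1) unfolding s_def by (intro mult_left_mono) auto
        finally have 2: "?g (n - j) * jap j powr (\<alpha> + 1) * h j \<le>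
            jap n powr (\<alpha> + 1) * (A' * s powr (\<alpha> + 1)) * (D' / s ^ Suc M) * h j"
          by (rule mult_right_mono) (rule h)
        have "?g (n - j) * \<bar>f j\<bar> \<le> ?g (n - j) * (jap j powr \<alpha> * (B + jap j * h j))"
          by (intro mult_left_mono f) auto
        also have "\<dots> = B * (?g (n - j) * jap j powr \<alpha>) + ?g (n - j) * jap j powr (\<alpha> + 1) * h j"
          using jap_pos[of j] by (simp add: powr_add algebra_simps)
        finally show ?thesis using 1 2 by linarith
      qed
      then have "(\<Sum>j\<in>F. ?g (n - j) * \<bar>f j\<bar>) \<le>
          (\<Sum>j\<in>F. B * jap n powr \<alpha> * (A * s powr \<alpha>) * (?g (n - j) * ?e (n - j)) +
            jap n powr (\<alpha> + 1) * (A' * s powr (\<alpha> + 1)) * (D' / s ^ Suc M) * h j)" by (rule sum_mono)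
      also have "\<dots> = B * jap n powr \<alpha> * (A * s powr \<alpha>) * (\<Sum>j\<in>F. ?g (n - j) * ?e (n - j)) +
          jap n powr (\<alpha> + 1) * (A' * s powr (\<alpha> + 1)) * (D' / s ^ Suc M) * (\<Sum>j\<in>F. h j)"
        by (simp only: sum.distrib sum_distrib_left)
      also have "\<dots> \<le> B * jap n powr \<alpha> * (A * s powr \<alpha>) * (D / s ^ M) +
          jap n powr (\<alpha> + 1) * (A' * s powr (\<alpha> + 1)) * (D' / s ^ Suc M) * H"
      proof (intro add_mono mult_left_mono)
        show "(\<Sum>j\<in>F. ?g (n - j) * ?e (n - j)) \<le> D / s ^ M"
          by (rule sum_convolution_weight_le(2)[OF F]) (use D(2)[OF t1] in \<open>simp add: s_def\<close>)
        show "sum h F \<le> H" unfolding H_def by (rule finite_sum_le_infsum[OF h(2) F]) (use h in auto)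
      qed (use B A A' D' s in auto)
      also have "\<dots> = C * s powr (\<alpha> - real M)"
        using s by (simp add: C_def powr_diff powr_add powr_realpow field_simps)
      finally show ?thesis .
    qed
    have "\<bar>(delta_right ^^ M) (heat_semigroup t f) n\<bar> \<le> (\<Sum>\<^sub>\<infinity>j\<in>UNIV. ?g (n - j) * \<bar>f j\<bar>)"
      and "(\<Sum>\<^sub>\<infinity>j\<in>UNIV. ?g (n - j) * \<bar>f j\<bar>) \<le> C * s powr (\<alpha> - real M)"
    proof -
      have ns: "(\<lambda>j. ?g (n - j) * \<bar>f j\<bar>) summable_on UNIV" "(\<Sum>\<^sub>\<infinity>j\<in>UNIV. ?g (n - j) * \<bar>f j\<bar>) \<le> C * s powr (\<alpha> - real M)"
        using nonneg_sums_bounded[OF _ fin] by auto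
      then show "\<bar>(delta_right ^^ M) (heat_semigroup t f) n\<bar> \<le> (\<Sum>\<^sub>\<infinity>j\<in>UNIV. ?g (n - j) * \<bar>f j\<bar>)"
        using norm_infsum_bound[of "\<lambda>j. (delta_right ^^ M) (heat_kernel t) (n - j) * f j" UNIV]
        by (simp add: rep abs_mult)
      show "(\<Sum>\<^sub>\<infinity>j\<in>UNIV. ?g (n - j) * \<bar>f j\<bar>) \<le> C * s powr (\<alpha> - real M)" by (rule ns)
    qed
    then show ?thesis unfolding s_def by linarith
  qed
  then show ?thesis by blast
qed

lemma delta_heat_semigroup_tendsto_0:
  assumes \<alpha>: "\<alpha> \<ge> 0" and B: "B \<ge> 0" and h: "\<And>j. 0 \<le> h j" "h summable_on UNIV"
    and f: "\<And>j. \<bar>f j\<bar> \<le> jap j powr \<alpha> * (B + jap j * h j)"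
    and K: "\<And>j. \<bar>f j\<bar> \<le> K * exp \<bar>real_of_int j\<bar>"
    and M: "real M > \<alpha>"
  shows "((\<lambda>t. (delta_right ^^ M) (heat_semigroup t f) n) \<longlongrightarrow> 0) at_top"
proof -
  obtain C where C: "\<And>t. t \<ge> 1 \<Longrightarrow> \<bar>(delta_right ^^ M) (heat_semigroup t f) n\<bar> \<le> C * width t powr (\<alpha> - real M)"
    using delta_heat_semigroup_le[OF \<alpha> B h f K, of M n] by blast
  have "filterlim width at_top at_top"
    unfolding width_def
    by (intro filterlim_compose[OF sqrt_at_top] filterlim_tendsto_add_at_top[OF tendsto_const] filterlim_ident)
  then have "((\<lambda>t. width t powr (\<alpha> - real M)) \<longlongrightarrow> 0) at_top"
    using M by (intro tendsto_neg_powr) auto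
  from tendsto_mult_right_zero[OF this, of C]
  have lim: "((\<lambda>t. C * width t powr (\<alpha> - real M)) \<longlongrightarrow> 0) at_top" .
  show ?thesis
    by (rule Lim_null_comparison[OF _ lim]) (use C in \<open>auto simp: eventually_at_top_linorder\<close>)
qed

theorem lemma2p4:
  fixes q :: ereal and \<alpha> :: real and f :: "int \<Rightarrow> real"
  assumes "1 \<le> q" and "\<alpha> > 0" and "in_lq_mu q (div_growth \<alpha> f)"
  shows "(\<forall>t>0. \<forall>n. (\<lambda>j. heat_kernel t (n - j) * f j) summable_on UNIV) \<and>
    (\<exists>C>0. \<forall>t>0. in_lq_mu q (div_growth \<alpha> (heat_semigroup t f)) \<and>
        lq_mu_norm q (div_growth \<alpha> (heat_semigroup t f))
          \<le> C * (1 + t powr ((\<alpha> + (if q = \<infinity> then 0 else 1 / real_of_ereal q)) / 2))) \<and>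
    (\<forall>(n::int) (m::nat) (l::nat). real m / 2 + real l > \<alpha> / 2 \<longrightarrow>
        (\<forall>k<l. \<forall>t>0. (deriv ^^ k) (\<lambda>s. (delta_right ^^ m) (heat_semigroup s f) n)
                          field_differentiable at t) \<and>
        ((\<lambda>t. (deriv ^^ l) (\<lambda>s. (delta_right ^^ m) (heat_semigroup s f) n) t) \<longlongrightarrow> 0) at_top)"
proof -
  have \<alpha>: "\<alpha> \<ge> 0" using assms(2) by simp
  \<comment> \<open>Only here the cases \<open>q = \<infinity>\<close> and \<open>q < \<infinity>\<close> differ: \<open>h = 0\<close> in the first, and twice the terms of the norm in the second.\<close>
  have "(\<exists>B h K. B \<ge> 0 \<and> (\<forall>j. 0 \<le> h j) \<and> h summable_on UNIV \<and>
        (\<forall>j. \<bar>f j\<bar> \<le> jap j powr \<alpha> * (B + jap j * h j)) \<and> (\<forall>j. \<bar>f j\<bar> \<le> K * exp \<bar>real_of_int j\<bar>)) \<and>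
      (\<exists>C>0. \<forall>t>0. in_lq_mu q (div_growth \<alpha> (heat_semigroup t f)) \<and>
        lq_mu_norm q (div_growth \<alpha> (heat_semigroup t f))
          \<le> C * (1 + t powr ((\<alpha> + (if q = \<infinity> then 0 else 1 / real_of_ereal q)) / 2)))"
    (is "?decomp \<and> ?bound")
  proof (cases "q = \<infinity>")
    case True
    then have "bounded (range (div_growth \<alpha> f))" using assms(3) by (simp add: in_lq_mu_def)
    then obtain B where "\<And>n. \<bar>div_growth \<alpha> f n\<bar> \<le> B" by (auto simp: bounded_iff)
    then have B: "\<bar>div_growth \<alpha> f n\<bar> \<le> \<bar>B\<bar>" for n by (meson abs_ge_self order_trans)
    have fB: "\<bar>f j\<bar> \<le> \<bar>B\<bar> * growth \<alpha> j" for j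
      using B[of j] growth_pos[of \<alpha> j] by (simp add: div_growth_eq divide_le_eq)
    have fj: "\<bar>f j\<bar> \<le> (2 * \<bar>B\<bar>) * jap j powr \<alpha>" for j
      using fB[of j] mult_left_mono[OF growth_le[OF \<alpha>, of j], of "\<bar>B\<bar>"] by (simp add: mult_ac)
    obtain K where "\<And>j. \<bar>f j\<bar> \<le> K * exp \<bar>real_of_int j\<bar>"
      using powr_growth_imp_exp_growth[OF \<alpha> fj] by blast
    then have ?decomp using fj
      by (intro exI[of _ "2 * \<bar>B\<bar>"] exI[of _ "\<lambda>_. 0"] exI[of _ K]) (auto simp: mult_ac)
    moreover have ?bound
    proof -
      obtain C where C: "C > 0" "\<And>t n. t > 0 \<Longrightarrow>
          \<bar>div_growth \<alpha> (heat_semigroup t f) n\<bar> \<le> C * (1 + t powr (\<alpha> / 2))"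
        using heat_semigroup_sup_bound[OF \<alpha> _ fB] by auto
      have "in_lq_mu q (div_growth \<alpha> (heat_semigroup t f))" if "t > 0" for t
        using C(2)[OF that] True by (auto simp: in_lq_mu_def bounded_iff)
      moreover have "lq_mu_norm q (div_growth \<alpha> (heat_semigroup t f)) \<le> C * (1 + t powr (\<alpha> / 2))" if "t > 0" for t
        unfolding lq_mu_norm_def using True C(2)[OF that] by (auto intro!: cSUP_least)
      ultimately show ?thesis using C(1) True by auto
    qed
    ultimately show ?thesis ..
  next
    case False
    then obtain r where q: "q = ereal r" "r \<ge> 1" using assms(1) by (cases q) auto
    have sm: "(\<lambda>n. \<bar>div_growth \<alpha> f n\<bar> powr r / jap n) summable_on UNIV"
      using assms(3) q by (simp add: in_lq_mu_def jap_def)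
    define a where "a n = \<bar>div_growth \<alpha> f n\<bar> powr r / jap n" for n
    have a: "0 \<le> a j" for j using jap_pos[of j] by (simp add: a_def)
    have \<gamma>: "\<alpha> * r + 1 \<ge> 0" using \<alpha> q by simp
    obtain K1 where K1: "\<And>j. \<bar>f j\<bar> powr r \<le> K1 * jap j powr (\<alpha> * r + 1)"
      using lq_mu_powr_growth[OF q(2) \<alpha> sm] by blast
    obtain K where K: "\<And>j. \<bar>f j\<bar> \<le> K * exp \<bar>real_of_int j\<bar>"
      using powr_growth_imp_exp_growth[OF \<gamma> powr_bound_imp_bound[OF q(2) \<gamma> K1]] by blast
    have "\<bar>f j\<bar> \<le> jap j powr \<alpha> * (2 + jap j * (2 * a j))" for j
    proof -
      have "\<bar>f j\<bar> = growth \<alpha> j * \<bar>div_growth \<alpha> f j\<bar>"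
        using growth_pos[of \<alpha> j] by (simp add: div_growth_eq)
      also have "\<dots> \<le> (2 * jap j powr \<alpha>) * (1 + \<bar>div_growth \<alpha> f j\<bar> powr r)"
        using growth_le[OF \<alpha>, of j] le_one_plus_powr[of "\<bar>div_growth \<alpha> f j\<bar>" r] q growth_pos[of \<alpha> j]
        by (intro mult_mono) auto
      also have "\<bar>div_growth \<alpha> f j\<bar> powr r = jap j * a j"
        using jap_pos[of j] by (simp add: a_def)
      finally show ?thesis by (simp add: algebra_simps)
    qed
    moreover have "(\<lambda>j. 2 * a j) summable_on UNIV"
      using sm unfolding a_def by (rule summable_on_cmult_right)
    ultimately have ?decomp using K a
      by (intro exI[of _ 2] exI[of _ "\<lambda>j. 2 * a j"] exI[of _ K]) auto
    moreover have ?bound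
      using heat_semigroup_lq_bound[OF q(2) \<alpha> sm] q by (simp add: in_lq_mu_def lq_mu_norm_def jap_def)
    ultimately show ?thesis ..
  qed
  then obtain B h K where B: "B \<ge> 0" and h: "\<And>j. 0 \<le> h j" "h summable_on UNIV"
    and f: "\<And>j. \<bar>f j\<bar> \<le> jap j powr \<alpha> * (B + jap j * h j)"
    and K: "\<And>j. \<bar>f j\<bar> \<le> K * exp \<bar>real_of_int j\<bar>" and bound: ?bound
    by blast
  have "\<forall>t>0. \<forall>n. (\<lambda>j. heat_kernel t (n - j) * f j) summable_on UNIV"
    using pois_pairs_has_sum_heat_semigroup(1)[OF _ K] by blast
  moreover have "(deriv ^^ k) (\<lambda>s. (delta_right ^^ m) (heat_semigroup s f) n) field_differentiable at t"
    if "t > 0" for k m n t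
    using higher_deriv_heat(2)[OF K that] unfolding field_differentiable_def by blast
  moreover have "((\<lambda>t. (deriv ^^ l) (\<lambda>s. (delta_right ^^ m) (heat_semigroup s f) n) t) \<longlongrightarrow> 0) at_top"
    if "real m / 2 + real l > \<alpha> / 2" for n m l
  proof -
    \<comment> \<open>Each time derivative counts as two differences.\<close>
    have "real (m + 2 * l) > \<alpha>" using that by simp
    from delta_heat_semigroup_tendsto_0[OF \<alpha> B h f K this]
    have lim: "((\<lambda>t. (delta_right ^^ (m + 2 * l)) (heat_semigroup t f) (n - int l)) \<longlongrightarrow> 0) at_top" .
    show ?thesis
      by (rule Lim_transform_eventually[OF lim])
        (use eventually_gt_at_top[of "0::real"] in \<open>eventually_elim, simp add: higher_deriv_heat(1)[OF K]\<close>)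
  qed
  ultimately show ?thesis using bound by blast
qed

end
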